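(* For every $n\ge1$, the number $\#AP_n$ of domino tilings of the Aztec pillow $AP_n$ is $$\#AP_n=\det\begin{bmatrix} S_n & I_n\\ -I_n & J_nS_nJ_n\end{bmatrix},$$ where $S_n$ is the $n\times n$ leading principal submatrix of the infinite upper-triangular array $S=(s_{i,j})_{i,j\ge0}$ of modified Schröder numbers and $J_n$ is the $n\times n$ exchange matrix.
   Context: The Aztec pillow $AP_n$ is the region in the plane formed by the unit squares whose vertices are integral points $(x,y)$ with $|x+y|\le n+1$ and $|3y-x|\le n+3$. It is symmetric under rotation by $180^\circ$, has $2n$ squares in each of its two central rows, and on its top left boundary the steps have three squares to the right for every square up. A domino tiling is a tiling by $1\times2$ and $2\times1$ rectangles made of two unit squares. Modified Schröder numbers: for $0\le i\le j$, $s_{i,j}$ is the number of lattice paths from $(i,i)$ to $(j,j)$ using steps $(0,1)$, $(1,0)$, $(1,1)$ that pass neither above the line $y=x$ nor below the line $y=x/2$; $s_{i,j}=0$ for $i>j$. Thus $S_n=(s_{i,j})_{0\le i,j\le n-1}$; for example $$S_4=\begin{bmatrix}1&1&2&5\\0&1&2&5\\0&0&1&2\\0&0&0&1\end{bmatrix}.$$ The exchange matrix $J_n$ has $1$'s on the skew-diagonal and $0$'s elsewhere. *)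

theory Defs
  imports "Jordan_Normal_Form.Determinant"
begin

text \<open>A pair \<open>(a, b)\<close> of integers stands for the unit square \<open>[a, a + 1] \<times> [b, b + 1]\<close>.\<close>

type_synonym cell = "int \<times> int"

definition vertices :: "cell \<Rightarrow> (int \<times> int) set" where
  "vertices c = {fst c, fst c + 1} \<times> {snd c, snd c + 1}"

definition aztec_pillow :: "nat \<Rightarrow> cell set" where
  "aztec_pillow n = {c. \<forall>(x, y) \<in> vertices c.
     \<bar>x + y\<bar> \<le> int n + 1 \<and> \<bar>3 * y - x\<bar> \<le> int n + 3}"

definition is_domino :: "cell set \<Rightarrow> bool" where
  "is_domino d \<longleftrightarrow> (\<exists>a b. d = {(a, b), (a + 1, b)} \<or> d = {(a, b), (a, b + 1)})"

definition domino_tilings :: "cell set \<Rightarrow> cell set set set" where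
  "domino_tilings R =
     {T. (\<forall>d\<in>T. is_domino d) \<and> pairwise disjnt T \<and> \<Union>T = R}"

definition schroeder_step :: "nat \<times> nat \<Rightarrow> nat \<times> nat \<Rightarrow> bool" where
  "schroeder_step p q \<longleftrightarrow>
     q \<in> {(fst p, snd p + 1), (fst p + 1, snd p), (fst p + 1, snd p + 1)}"

text \<open>
  A path is the list of its successive lattice points. The region between the lines \<open>y = x / 2\<close>
  and \<open>y = x\<close> is convex, so a path stays inside it as soon as its lattice points do.
\<close>

definition modified_schroeder_paths :: "nat \<Rightarrow> nat \<Rightarrow> (nat \<times> nat) list set" where
  "modified_schroeder_paths i j =
     {ps. ps \<noteq> [] \<and> hd ps = (i, i) \<and> last ps = (j, j) \<and> successively schroeder_step ps \<and>
          (\<forall>(x, y) \<in> set ps. y \<le> x \<and> real y \<ge> real x / 2)}"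

definition modified_schroeder :: "nat \<Rightarrow> nat \<Rightarrow> nat" where
  "modified_schroeder i j = (if i \<le> j then card (modified_schroeder_paths i j) else 0)"

definition modified_schroeder_mat :: "nat \<Rightarrow> int mat" where
  "modified_schroeder_mat n = mat n n (\<lambda>(i, j). int (modified_schroeder i j))"

definition exchange_mat :: "nat \<Rightarrow> int mat" where
  "exchange_mat n = mat n n (\<lambda>(i, j). if i + j + 1 = n then 1 else 0)"

end

theory Submission
  imports Defs "HOL-Library.Product_Lexorder"
begin

text \<open>
  Pairing each cell with its horizontal neighbour tiles the pillow by horizontal dominoes, and
  comparing an arbitrary tiling with this one turns it into a permutation of the reference dominoes.
  A reference domino is a point of the Schroeder region in one of the two halves, and the
  permutation moves it by a Schroeder step, leaves it fixed, or crosses the central line. So the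
  tilings are the nonzero terms of the determinant of \<open>K = 1 - A + Z\<close>, with \<open>A\<close> the steps
  inside the halves and \<open>Z\<close> the crossings, signed by direction; all these terms equal 1. Since
  \<open>1 - A\<close> has determinant 1 and inverse \<open>G\<close>, the path counts, \<open>det K = det (1 + Z G)\<close>. Only
  the rows of the central points of \<open>Z G\<close> are nonzero, which leaves \<open>det (1 + J S J S)\<close>.

  For the sign of a term, order the cells row by row. The parity of the permutation is the number
  of pairs of interleaving dominoes plus the number of dominoes in which the order of the two
  colours is reversed. Only vertical dominoes interleave, and the number of later dominoes that
  interleave with a given one has a parity that depends only on the position of its upper cell,
  because the cells to the left of it that belong to horizontal dominoes are even in number.
\<close>

subsection \<open>Determinants indexed by finite sets\<close>

definition det_on :: "'a set \<Rightarrow> ('a \<Rightarrow> 'a \<Rightarrow> 'b) \<Rightarrow> 'b :: comm_ring_1" where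
  "det_on A M = (\<Sum>p | p permutes A. of_int (sign p) * (\<Prod>a\<in>A. M a (p a)))"

lemma det_on_cong:
  assumes "\<And>a b. a \<in> A \<Longrightarrow> b \<in> A \<Longrightarrow> M a b = N a b"
  shows "det_on A M = det_on A N"
  unfolding det_on_def
  by (intro sum.cong refl arg_cong2[where f = "(*)"] prod.cong)
     (use assms in \<open>auto simp: permutes_in_image\<close>)

lemma bij_betw_map_permutation:
  assumes "bij_betw f A B"
  shows "bij_betw (map_permutation A f) {p. p permutes A} {p. p permutes B}"
proof (rule bij_betw_byWitness[where f' = "map_permutation B (inv_into A f)"])
  have inj: "inj_on f A" and img: "f ` A = B" using assms by (auto simp: bij_betw_def)
  have inv: "bij_betw (inv_into A f) B A" using assms by (rule bij_betw_inv_into)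
  show "\<forall>p\<in>{p. p permutes A}. map_permutation B (inv_into A f) (map_permutation A f p) = p"
    using inj by (auto intro: map_permutation_compose_inv[OF assms])
  show "\<forall>p\<in>{p. p permutes B}. map_permutation A f (map_permutation B (inv_into A f) p) = p"
    using map_permutation_compose_inv[OF inv] f_inv_into_f[of _ f A] img by auto
  show "map_permutation A f ` {p. p permutes A} \<subseteq> {p. p permutes B}"
    using map_permutation_permutes[OF assms] by auto
  show "map_permutation B (inv_into A f) ` {p. p permutes B} \<subseteq> {p. p permutes A}"
    using map_permutation_permutes[OF inv] by auto
qed

lemma det_on_bij_betw:
  fixes M :: "'a \<Rightarrow> 'a \<Rightarrow> 'b :: comm_ring_1"
  assumes f: "bij_betw f A B" and "finite A"
  shows "det_on B M = det_on A (\<lambda>a b. M (f a) (f b))"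
proof -
  have inj: "inj_on f A" using f by (auto simp: bij_betw_def)
  have "det_on B M = (\<Sum>p | p permutes A. of_int (sign (map_permutation A f p)) *
          (\<Prod>b\<in>B. M b (map_permutation A f p b)))"
    unfolding det_on_def by (rule sum.reindex_bij_betw[OF bij_betw_map_permutation[OF f], symmetric])
  also have "\<dots> = det_on A (\<lambda>a b. M (f a) (f b))"
    unfolding det_on_def
  proof (intro sum.cong refl arg_cong2[where f = "(*)"])
    fix p assume "p \<in> {p. p permutes A}"
    then have p: "p permutes A" by simp
    show "(of_int (sign (map_permutation A f p)) :: 'b) = of_int (sign p)"
      using sign_map_permutation[OF inj p \<open>finite A\<close>] by simp
    show "(\<Prod>b\<in>B. M b (map_permutation A f p b)) = (\<Prod>a\<in>A. M (f a) (f (p a)))"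
      by (subst prod.reindex_bij_betw[OF f, symmetric])
         (intro prod.cong refl, simp add: map_permutation_apply[OF inj])
  qed
  finally show ?thesis .
qed

lemma det_on_conv_det:
  assumes "bij_betw f {0..<N} A"
  shows "det_on A M = det (mat N N (\<lambda>(i, j). M (f i) (f j)))"
  by (subst det_on_bij_betw[OF assms]) (auto simp: det_on_def det_def intro!: sum.cong prod.cong)

lemma det_on_mult:
  fixes M N :: "'a \<Rightarrow> 'a \<Rightarrow> 'b :: comm_ring_1"
  assumes "finite A"
  shows "det_on A (\<lambda>a b. \<Sum>c\<in>A. M a c * N c b) = det_on A M * det_on A N"
proof -
  define n where "n = card A"
  obtain f where f: "bij_betw f {0..<n} A"
    using ex_bij_betw_nat_finite[OF assms] n_def by blast
  let ?m = "\<lambda>M :: 'a \<Rightarrow> 'a \<Rightarrow> 'b. mat n n (\<lambda>(i, j). M (f i) (f j))"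
  have "?m (\<lambda>a b. \<Sum>c\<in>A. M a c * N c b) = ?m M * ?m N"
    by (rule eq_matI) (auto simp: scalar_prod_def sum.reindex_bij_betw[OF f, symmetric])
  moreover have "det (?m M * ?m N) = det (?m M) * det (?m N)"
    by (rule det_mult[of _ n]) auto
  ultimately show ?thesis by (simp add: det_on_conv_det[OF f])
qed

text \<open>A row that is a unit vector forces every nonzero term to fix its index, so only the
  permutations of \<open>B\<close> survive.\<close>

lemma det_on_identity_rows:
  assumes "finite A" "B \<subseteq> A"
    and rows: "\<And>a b. a \<in> A - B \<Longrightarrow> b \<in> A \<Longrightarrow> M a b = (if a = b then 1 else 0)"
  shows "det_on A M = det_on B M"
proof -
  have sub: "{p. p permutes B} \<subseteq> {p. p permutes A}"
    using assms(2) by (auto intro: permutes_subset)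
  have fixed: "(\<Prod>a\<in>A. M a (p a)) = (\<Prod>a\<in>B. M a (p a))" if "p permutes B" for p
  proof (rule prod.mono_neutral_right[OF assms(1,2)], safe)
    fix a assume "a \<in> A" "a \<notin> B"
    then show "M a (p a) = 1" using rows[of a a] permutes_not_in[OF that] by auto
  qed
  have zero: "(\<Prod>a\<in>A. M a (p a)) = 0" if p: "p permutes A" "\<not> p permutes B" for p
  proof -
    obtain a where a: "a \<in> A - B" "p a \<noteq> a"
      using p permutes_superset[of p A B] by blast
    then have "M a (p a) = 0" using rows[of a "p a"] p(1) by (auto simp: permutes_in_image)
    then show ?thesis using a(1) assms(1) by (intro prod_zero) auto
  qed
  have "det_on A M = (\<Sum>p | p permutes B. of_int (sign p) * (\<Prod>a\<in>A. M a (p a)))"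
    unfolding det_on_def using assms(1) sub zero
    by (intro sum.mono_neutral_right) (auto simp: finite_permutations)
  also have "\<dots> = det_on B M"
    unfolding det_on_def using fixed by (intro sum.cong) auto
  finally show ?thesis .
qed

text \<open>Off the diagonal an entry can be nonzero only where \<open>\<phi>\<close> strictly
  rises. A permutation cannot raise \<open>\<phi>\<close> somewhere without lowering it elsewhere,
  so the identity gives the only nonzero term.\<close>

lemma det_on_acyclic:
  fixes M :: "'a \<Rightarrow> 'a \<Rightarrow> 'b :: comm_ring_1" and \<phi> :: "'a \<Rightarrow> nat"
  assumes "finite A" and diag: "\<And>a. a \<in> A \<Longrightarrow> M a a = 1"
    and off: "\<And>a b. a \<in> A \<Longrightarrow> b \<in> A \<Longrightarrow> a \<noteq> b \<Longrightarrow> M a b \<noteq> 0 \<Longrightarrow> \<phi> a < \<phi> b"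
  shows "det_on A M = 1"
proof -
  have zero: "(\<Prod>a\<in>A. M a (p a)) = 0" if p: "p permutes A" "p \<noteq> id" for p
  proof (rule ccontr)
    assume "(\<Prod>a\<in>A. M a (p a)) \<noteq> 0"
    then have nz: "M a (p a) \<noteq> 0" if "a \<in> A" for a using that assms(1) by (metis prod_zero)
    have le: "\<phi> a \<le> \<phi> (p a)" if "a \<in> A" for a
      using off[OF that _ _ nz[OF that]] that p(1) by (cases "p a = a") (auto simp: permutes_in_image)
    obtain a where a: "p a \<noteq> a" using p(2) by (auto simp: fun_eq_iff)
    then have aA: "a \<in> A" using p(1) by (metis permutes_not_in)
    have "(\<Sum>a\<in>A. \<phi> a) < (\<Sum>a\<in>A. \<phi> (p a))"
      using aA a off[OF aA _ _ nz[OF aA]] p(1) le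
      by (intro sum_strict_mono_ex1[OF assms(1)]) (auto simp: permutes_in_image)
    moreover have "(\<Sum>a\<in>A. \<phi> (p a)) = (\<Sum>a\<in>A. \<phi> a)"
      using sum.permute[OF p(1), of \<phi>] by (simp add: o_def)
    ultimately show False by simp
  qed
  have "det_on A M = (\<Sum>p\<in>{id}. of_int (sign p) * (\<Prod>a\<in>A. M a (p a)))"
    unfolding det_on_def using assms(1) zero
    by (intro sum.mono_neutral_right) (auto simp: finite_permutations permutes_id)
  then show ?thesis using diag by simp
qed

subsection \<open>Signs of permutations and order\<close>

text \<open>The value at equal arguments is -1 and not 0, so that the square is 1 in every
  case.\<close>

definition order_sign :: "'a :: linorder \<Rightarrow> 'a \<Rightarrow> int" where
  "order_sign x y = (if x < y then 1 else - 1)"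

lemma order_sign_square [simp]: "order_sign x y * order_sign x y = 1"
  by (simp add: order_sign_def)

lemma order_sign_swap: "x \<noteq> y \<Longrightarrow> order_sign y x = - order_sign x y"
  by (auto simp: order_sign_def)

text \<open>When \<open>\<kappa>\<close> is injective on \<open>A\<close>, every two-element subset
  is listed once, so a product over this set is a product over unordered pairs.\<close>

definition increasing_pairs :: "('a \<Rightarrow> 'b :: linorder) \<Rightarrow> 'a set \<Rightarrow> ('a \<times> 'a) set" where
  "increasing_pairs \<kappa> A = {(a, b). a \<in> A \<and> b \<in> A \<and> \<kappa> a < \<kappa> b}"

lemma finite_increasing_pairs [simp]: "finite A \<Longrightarrow> finite (increasing_pairs \<kappa> A)"
  by (rule finite_subset[of _ "A \<times> A"]) (auto simp: increasing_pairs_def)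

text \<open>A bijection carries unordered pairs to unordered pairs, and a symmetric \<open>h\<close>
  does not see in which order a pair is listed. Hence the map \<open>q\<close> can be removed and
  the key changed at once.\<close>

lemma prod_increasing_pairs_reindex:
  fixes h :: "'c \<Rightarrow> 'c \<Rightarrow> 'd :: comm_monoid_mult"
  assumes q: "bij_betw q A B" and \<kappa>: "inj_on \<kappa> A" and \<mu>: "inj_on \<mu> B"
    and sym: "\<And>x y. x \<in> B \<Longrightarrow> y \<in> B \<Longrightarrow> h x y = h y x"
  shows "(\<Prod>(a, b)\<in>increasing_pairs \<kappa> A. h (q a) (q b)) = (\<Prod>(x, y)\<in>increasing_pairs \<mu> B. h x y)"
proof -
  define r where "r = inv_into A q"
  have r: "\<And>y. y \<in> B \<Longrightarrow> r y \<in> A" "\<And>y. y \<in> B \<Longrightarrow> q (r y) = y" "\<And>a. a \<in> A \<Longrightarrow> r (q a) = a"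
      "\<And>a. a \<in> A \<Longrightarrow> q a \<in> B"
    using q bij_betw_inv_into_left[OF q] bij_betw_inv_into_right[OF q]
    unfolding r_def by (auto simp: bij_betw_def inv_into_into)
  have inj: "\<And>a b. a \<in> A \<Longrightarrow> b \<in> A \<Longrightarrow> q a = q b \<Longrightarrow> a = b"
    using q by (auto simp: bij_betw_def inj_on_def)
  have \<kappa>': "\<kappa> a < \<kappa> b \<or> \<kappa> b < \<kappa> a" if "a \<in> A" "b \<in> A" "a \<noteq> b" for a b
    using that \<kappa> by (metis inj_onD neqE)
  have \<mu>': "\<mu> a < \<mu> b \<or> \<mu> b < \<mu> a" if "a \<in> B" "b \<in> B" "a \<noteq> b" for a b
    using that \<mu> by (metis inj_onD neqE)
  define i where "i = (\<lambda>(x, y). if \<kappa> (r x) < \<kappa> (r y) then (r x, r y) else (r y, r x))"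
  define j where "j = (\<lambda>(a, b). if \<mu> (q a) < \<mu> (q b) then (q a, q b) else (q b, q a))"
  show ?thesis
  proof (rule prod.reindex_bij_witness[of _ i j])
    fix z assume "z \<in> increasing_pairs \<kappa> A"
    then obtain a b where z: "z = (a, b)" "a \<in> A" "b \<in> A" "\<kappa> a < \<kappa> b"
      by (auto simp: increasing_pairs_def)
    then have "q a \<noteq> q b" using inj by blast
    then show "j z \<in> increasing_pairs \<mu> B" "i (j z) = z"
      "(case j z of (x, y) \<Rightarrow> h x y) = (case z of (a, b) \<Rightarrow> h (q a) (q b))"
      using z r \<mu>'[of "q a" "q b"] sym by (auto simp: i_def j_def increasing_pairs_def)
  next
    fix z assume "z \<in> increasing_pairs \<mu> B"
    then obtain x y where z: "z = (x, y)" "x \<in> B" "y \<in> B" "\<mu> x < \<mu> y"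
      by (auto simp: increasing_pairs_def)
    then have "r x \<noteq> r y" using r(2) by (metis less_irrefl)
    then show "i z \<in> increasing_pairs \<kappa> A" "j (i z) = z"
      using z r \<kappa>'[of "r x" "r y"] by (auto simp: i_def j_def increasing_pairs_def)
  qed
qed

text \<open>Exchanging \<open>c\<close> and \<open>d\<close> inverts the pair itself and, for each
  element strictly between them, its pair with \<open>c\<close> and its pair with \<open>d\<close>:
  an odd number of pairs.\<close>

lemma prod_order_sign_transpose:
  fixes \<kappa> :: "'a \<Rightarrow> 'b :: linorder"
  assumes "finite A" "inj_on \<kappa> A" "c \<in> A" "d \<in> A" "\<kappa> c < \<kappa> d"
  shows "(\<Prod>(a, b)\<in>increasing_pairs \<kappa> A.
            order_sign (\<kappa> (transpose c d a)) (\<kappa> (transpose c d b))) = - 1"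
proof -
  define X where "X = {x \<in> A. \<kappa> c < \<kappa> x \<and> \<kappa> x < \<kappa> d}"
  let ?t = "Transposition.transpose c d"
  let ?P = "increasing_pairs \<kappa> A"
  let ?S = "{(a, b) \<in> ?P. \<not> \<kappa> (?t a) < \<kappa> (?t b)}"
  have eq: "\<kappa> x = \<kappa> y \<longleftrightarrow> x = y" if "x \<in> A" "y \<in> A" for x y
    using assms(2) that by (auto simp: inj_on_def)
  have S: "?S = {(c, d)} \<union> (Pair c ` X \<union> (\<lambda>x. (x, d)) ` X)" (is "_ = ?R")
  proof (intro equalityI subsetI)
    fix z assume "z \<in> ?S"
    then show "z \<in> ?R" using assms(3-5) eq
      by (cases "fst z = c"; cases "fst z = d"; cases "snd z = c"; cases "snd z = d")
         (auto simp: increasing_pairs_def X_def not_less order.order_iff_strict)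
  next
    fix z assume "z \<in> ?R"
    then show "z \<in> ?S" using assms(3-5)
      by (auto simp: increasing_pairs_def X_def transpose_def)
  qed
  have fX: "finite X" using assms(1) by (simp add: X_def)
  have "card ?S = Suc (card (Pair c ` X \<union> (\<lambda>x. (x, d)) ` X))"
    unfolding S using fX by (simp add: X_def image_iff)
  also have "card (Pair c ` X \<union> (\<lambda>x. (x, d)) ` X) = card X + card X"
    using fX by (subst card_Un_disjoint) (auto simp: X_def card_image inj_on_def)
  finally have odd: "odd (card ?S)" by simp
  have "(\<Prod>(a, b)\<in>?P. order_sign (\<kappa> (?t a)) (\<kappa> (?t b))) = (\<Prod>z\<in>?P. if z \<in> ?S then - 1 else 1)"
    by (intro prod.cong) (auto simp: order_sign_def)
  also have "\<dots> = (\<Prod>z\<in>?S. - 1)"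
    by (subst prod.inter_filter[symmetric])
       (use assms(1) in \<open>auto intro!: arg_cong2[where f = prod] simp: case_prod_unfold cong: conj_cong\<close>)
  also have "\<dots> = - 1" using odd by simp
  finally show ?thesis .
qed

text \<open>Induction over transpositions: inversion signs multiply under composition, and one
  transposition contributes -1.\<close>

lemma sign_conv_prod_order_sign:
  fixes \<kappa> :: "'a \<Rightarrow> 'b :: linorder"
  assumes "p permutes A" "finite A" "inj_on \<kappa> A"
  shows "sign p = (\<Prod>(a, b)\<in>increasing_pairs \<kappa> A. order_sign (\<kappa> (p a)) (\<kappa> (p b)))"
  using assms(1,2)
proof (induction rule: permutes_induct)
  case id
  then show ?case
    by (auto simp: order_sign_def increasing_pairs_def intro!: prod.neutral)
next
  case (swap c d p)
  let ?P = "increasing_pairs \<kappa> A"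
  let ?t = "Transposition.transpose c d"
  have t: "?t permutes A" using swap.hyps by (intro permutes_swap_id)
  \<comment> \<open>The sign with which the transposition acts on a pair. Exchanging
    \<open>x\<close> and \<open>y\<close> flips both factors, so \<open>h\<close> is symmetric and
    its product can be reindexed by \<open>p\<close>.\<close>
  define h where "h = (\<lambda>x y. order_sign (\<kappa> (?t x)) (\<kappa> (?t y)) * order_sign (\<kappa> x) (\<kappa> y))"
  have sym: "h x y = h y x" if "x \<in> A" "y \<in> A" for x y
  proof (cases "x = y")
    case False
    then have "?t x \<noteq> ?t y" by (metis transpose_involutory)
    then have "\<kappa> (?t x) \<noteq> \<kappa> (?t y)" "\<kappa> x \<noteq> \<kappa> y"
      using that False assms(3) t by (auto simp: inj_on_def permutes_in_image)
    then show ?thesis by (simp add: h_def order_sign_swap[of "\<kappa> x"] order_sign_swap[of "\<kappa> (?t x)"])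
  qed simp
  have "(\<Prod>(a, b)\<in>?P. order_sign (\<kappa> ((?t \<circ> p) a)) (\<kappa> ((?t \<circ> p) b))) =
      (\<Prod>(a, b)\<in>?P. h (p a) (p b) * order_sign (\<kappa> (p a)) (\<kappa> (p b)))"
    by (intro prod.cong) (auto simp: h_def mult.assoc)
  also have "\<dots> = (\<Prod>(a, b)\<in>?P. h (p a) (p b)) * sign p"
    by (subst swap.IH) (simp add: prod.distrib case_prod_unfold)
  also have "(\<Prod>(a, b)\<in>?P. h (p a) (p b)) = (\<Prod>(a, b)\<in>?P. h a b)"
    by (rule prod_increasing_pairs_reindex)
       (use swap.hyps assms sym in \<open>auto simp: permutes_imp_bij\<close>)
  also have "\<dots> = (\<Prod>(a, b)\<in>?P. order_sign (\<kappa> (?t a)) (\<kappa> (?t b)))"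
    by (intro prod.cong) (auto simp: h_def increasing_pairs_def order_sign_def)
  also have "\<dots> = - 1"
  proof (cases "\<kappa> c < \<kappa> d")
    case True
    then show ?thesis using prod_order_sign_transpose[of A \<kappa> c d] swap assms by auto
  next
    case False
    then have "\<kappa> d < \<kappa> c" using swap.hyps assms(3) by (metis inj_onD neqE)
    then show ?thesis using prod_order_sign_transpose[of A \<kappa> d c] swap assms
      by (simp add: transpose_commute)
  qed
  also have "- 1 * sign p = sign (?t \<circ> p)"
    using swap.hyps assms(2) permutes_imp_permutation[of A p]
    by (subst sign_compose) (auto simp: sign_swap_id permutation_swap_id)
  finally show ?case ..
qed

text \<open>For distinct keys this is -1 exactly when one of \<open>v\<close>, \<open>v'\<close>
  lies between \<open>u\<close> and \<open>u'\<close> and the other does not, that is, when the two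
  pairs interleave.\<close>

definition crossing_sign :: "('c \<Rightarrow> 'k :: linorder) \<Rightarrow> 'c \<Rightarrow> 'c \<Rightarrow> 'c \<Rightarrow> 'c \<Rightarrow> int" where
  "crossing_sign \<kappa> u u' v v' =
    order_sign (\<kappa> u) (\<kappa> v) * order_sign (\<kappa> u) (\<kappa> v') *
    order_sign (\<kappa> u') (\<kappa> v) * order_sign (\<kappa> u') (\<kappa> v')"

lemma crossing_sign_commute:
  "crossing_sign \<kappa> u' u v v' = crossing_sign \<kappa> u u' v v'"
  "crossing_sign \<kappa> u u' v' v = crossing_sign \<kappa> u u' v v'"
  by (simp_all add: crossing_sign_def mult_ac)

lemma crossing_sign_swap:
  assumes "\<kappa> u \<noteq> \<kappa> v" "\<kappa> u \<noteq> \<kappa> v'" "\<kappa> u' \<noteq> \<kappa> v" "\<kappa> u' \<noteq> \<kappa> v'"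
  shows "crossing_sign \<kappa> v v' u u' = crossing_sign \<kappa> u u' v v'"
  by (simp add: crossing_sign_def order_sign_swap[OF assms(1)] order_sign_swap[OF assms(2)]
      order_sign_swap[OF assms(3)] order_sign_swap[OF assms(4)] mult_ac)

lemma prod_increasing_pairs_both:
  fixes h :: "'a \<Rightarrow> 'a \<Rightarrow> 'd :: comm_monoid_mult"
  assumes "finite A" "inj_on \<kappa> A"
  shows "(\<Prod>(a, b)\<in>increasing_pairs \<kappa> A. h a b * h b a) * (\<Prod>a\<in>A. h a a) =
    (\<Prod>a\<in>A. \<Prod>b\<in>A. h a b)"
proof -
  let ?P = "increasing_pairs \<kappa> A"
  have fin: "finite ?P" using assms(1) by simp
  have AA: "A \<times> A = (?P \<union> prod.swap ` ?P) \<union> (\<lambda>a. (a, a)) ` A"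
  proof (intro equalityI subsetI)
    fix z assume "z \<in> A \<times> A"
    then obtain a b where z: "z = (a, b)" "a \<in> A" "b \<in> A" by auto
    then consider "a = b" | "\<kappa> a < \<kappa> b" | "\<kappa> b < \<kappa> a" using assms(2) by (metis inj_onD neqE)
    then show "z \<in> (?P \<union> prod.swap ` ?P) \<union> (\<lambda>a. (a, a)) ` A"
      using z by cases (force simp: increasing_pairs_def)+
  qed (auto simp: increasing_pairs_def)
  have "(\<Prod>a\<in>A. \<Prod>b\<in>A. h a b) = (\<Prod>(a, b)\<in>A \<times> A. h a b)"
    by (simp add: prod.cartesian_product)
  also have "\<dots> = (\<Prod>(a, b)\<in>?P \<union> prod.swap ` ?P. h a b) * (\<Prod>(a, b)\<in>(\<lambda>a. (a, a)) ` A. h a b)"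
    unfolding AA using assms(1) fin by (intro prod.union_disjoint) (auto simp: increasing_pairs_def)
  also have "(\<Prod>(a, b)\<in>?P \<union> prod.swap ` ?P. h a b) =
      (\<Prod>(a, b)\<in>?P. h a b) * (\<Prod>(a, b)\<in>prod.swap ` ?P. h a b)"
    using fin by (intro prod.union_disjoint) (auto simp: increasing_pairs_def)
  also have "(\<Prod>(a, b)\<in>prod.swap ` ?P. h a b) = (\<Prod>(a, b)\<in>?P. h b a)"
    by (subst prod.reindex) (auto simp: case_prod_unfold)
  also have "(\<Prod>(a, b)\<in>(\<lambda>a. (a, a)) ` A. h a b) = (\<Prod>a\<in>A. h a a)"
    by (subst prod.reindex) (auto simp: inj_on_def)
  finally show ?thesis by (simp add: prod.distrib case_prod_unfold)
qed

lemma prod_order_sign_square [simp]: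
  "(\<Prod>a\<in>A. order_sign (x a) (y a)) * (\<Prod>a\<in>A. order_sign (x a) (y a)) = 1"
  by (simp flip: prod.distrib)

text \<open>Compares a matching with the reference matching. Each inversion sign of the images is a
  crossing sign times off-diagonal factors \<open>h\<close>; together with the diagonal these fill
  up a product over \<open>V \<times> V\<close> that does not depend on \<open>p\<close>. Applying
  the formula to the identity as well removes this constant.\<close>

lemma sign_eq_prod_crossing_sign:
  fixes f g :: "'a \<Rightarrow> 'c" and \<kappa> :: "'c \<Rightarrow> 'k :: linorder"
  assumes p: "p permutes V" and fin: "finite V"
    and inj_f: "inj_on (\<kappa> \<circ> f) V" and inj_g: "inj_on (\<kappa> \<circ> g) V"
    and fg: "\<And>a b. a \<in> V \<Longrightarrow> b \<in> V \<Longrightarrow> \<kappa> (f a) \<noteq> \<kappa> (g b)"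
    and mono: "\<And>a b. a \<in> V \<Longrightarrow> b \<in> V \<Longrightarrow> \<kappa> (f a) < \<kappa> (f b) \<longleftrightarrow> \<kappa> (g a) < \<kappa> (g b)"
  shows "sign p =
    (\<Prod>(a, b)\<in>increasing_pairs (\<kappa> \<circ> f) V. crossing_sign \<kappa> (f a) (g (p a)) (f b) (g (p b))) *
    (\<Prod>a\<in>V. order_sign (\<kappa> (f a)) (\<kappa> (g (p a)))) *
    ((\<Prod>(a, b)\<in>increasing_pairs (\<kappa> \<circ> f) V. crossing_sign \<kappa> (f a) (g a) (f b) (g b)) *
     (\<Prod>a\<in>V. order_sign (\<kappa> (f a)) (\<kappa> (g a))))"
proof -
  let ?P = "increasing_pairs (\<kappa> \<circ> f) V"
  define X where "X p = (\<Prod>(a, b)\<in>?P. crossing_sign \<kappa> (f a) (g (p a)) (f b) (g (p b)))" for p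
  define Y where "Y p = (\<Prod>a\<in>V. order_sign (\<kappa> (f a)) (\<kappa> (g (p a))))" for p
  define C where "C = (\<Prod>a\<in>V. \<Prod>b\<in>V. order_sign (\<kappa> (f a)) (\<kappa> (g b)))"
  define m where "m = (- 1 :: int) ^ card ?P"
  have eq_P: "increasing_pairs (\<kappa> \<circ> g) V = ?P"
    using mono by (auto simp: increasing_pairs_def)
  have sign: "sign p = m * C * (X p * Y p)" if p: "p permutes V" for p
  proof -
    define h where "h a b = order_sign (\<kappa> (f a)) (\<kappa> (g (p b)))" for a b
    have pV: "p a \<in> V" if "a \<in> V" for a using p that by (simp add: permutes_in_image)
    have "sign p = (\<Prod>(a, b)\<in>?P. order_sign (\<kappa> (g (p a))) (\<kappa> (g (p b))))"
      using sign_conv_prod_order_sign[OF p fin inj_g] by (simp add: eq_P)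
    also have "\<dots> = (\<Prod>(a, b)\<in>?P. crossing_sign \<kappa> (f a) (g (p a)) (f b) (g (p b)) *
        (- 1 * (h a b * h b a)))"
    proof (intro prod.cong refl, clarify)
      fix a b assume ab: "(a, b) \<in> ?P"
      then have V: "a \<in> V" "b \<in> V" and less: "\<kappa> (f a) < \<kappa> (f b)"
        by (auto simp: increasing_pairs_def)
      have swap: "order_sign (\<kappa> (g (p a))) (\<kappa> (f b)) = - h b a"
        unfolding h_def by (rule order_sign_swap) (use fg V pV in auto)
      have one: "order_sign (\<kappa> (f a)) (\<kappa> (f b)) = 1" using less by (simp add: order_sign_def)
      have sq: "h a b * h a b = 1" "h b a * h b a = 1" by (simp_all add: h_def)
      have "crossing_sign \<kappa> (f a) (g (p a)) (f b) (g (p b)) * (- 1 * (h a b * h b a)) =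
          (h a b * h a b) * (h b a * h b a) * order_sign (\<kappa> (g (p a))) (\<kappa> (g (p b)))"
        by (simp add: crossing_sign_def swap one) (simp add: h_def mult_ac)
      then show "order_sign (\<kappa> (g (p a))) (\<kappa> (g (p b))) =
          crossing_sign \<kappa> (f a) (g (p a)) (f b) (g (p b)) * (- 1 * (h a b * h b a))"
        by (simp add: sq)
    qed
    also have "\<dots> = X p * (m * (\<Prod>(a, b)\<in>?P. h a b * h b a))"
      by (simp only: X_def m_def prod.distrib case_prod_unfold prod_constant)
    \<comment> \<open>\<open>Y p\<close> is the product of the diagonal entries of \<open>h\<close>.
      Inserting its square supplies the missing diagonal and leaves one copy of
      \<open>Y p\<close>.\<close>
    also have "(\<Prod>(a, b)\<in>?P. h a b * h b a) = (\<Prod>(a, b)\<in>?P. h a b * h b a) * (Y p * Y p)"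
      by (simp add: Y_def)
    also have "\<dots> = ((\<Prod>(a, b)\<in>?P. h a b * h b a) * (\<Prod>a\<in>V. h a a)) * Y p"
      by (simp add: Y_def h_def mult_ac)
    also have "(\<Prod>(a, b)\<in>?P. h a b * h b a) * (\<Prod>a\<in>V. h a a) = (\<Prod>a\<in>V. \<Prod>b\<in>V. h a b)"
      by (rule prod_increasing_pairs_both[OF fin inj_f])
    also have "\<dots> = C"
      unfolding C_def h_def
    proof (rule prod.cong[OF refl])
      fix a
      show "(\<Prod>b\<in>V. order_sign (\<kappa> (f a)) (\<kappa> (g (p b)))) = (\<Prod>b\<in>V. order_sign (\<kappa> (f a)) (\<kappa> (g b)))"
        using prod.permute[OF p, of "\<lambda>b. order_sign (\<kappa> (f a)) (\<kappa> (g b))"] by (simp add: o_def)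
    qed
    finally show ?thesis by (simp add: mult_ac)
  qed
  have squares: "m * m = 1" "C * C = 1"
    by (simp_all add: m_def C_def flip: power_add prod.distrib)
  \<comment> \<open>The identity has sign 1, which determines the constant \<open>m * C\<close> as
    \<open>X id * Y id\<close>.\<close>
  have "m * C = m * C * (m * C * (X id * Y id))" using sign[OF permutes_id] by simp
  also have "\<dots> = (m * m) * (C * C) * (X id * Y id)" by (simp only: mult_ac)
  finally have "sign p = X p * Y p * (X id * Y id)" using sign[OF p] squares by simp
  then show ?thesis by (simp add: X_def Y_def)
qed

subsection \<open>Walks in the Schroeder region\<close>

definition walks :: "('a \<Rightarrow> 'a \<Rightarrow> bool) \<Rightarrow> 'a set \<Rightarrow> 'a \<Rightarrow> 'a \<Rightarrow> 'a list set" where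
  "walks E V a b = {ps. ps \<noteq> [] \<and> hd ps = a \<and> last ps = b \<and> successively E ps \<and> set ps \<subseteq> V}"

lemma finite_walks:
  fixes \<phi> :: "'a \<Rightarrow> nat"
  assumes "finite V" and "\<And>a b. E a b \<Longrightarrow> \<phi> a < \<phi> b"
  shows "finite (walks E V a b)"
proof (rule finite_subset[OF _ finite_subset_distinct[OF assms(1)]], safe)
  fix ps x assume "ps \<in> walks E V a b"
  then have ps: "successively E ps" "set ps \<subseteq> V" by (auto simp: walks_def)
  then show "x \<in> set ps \<Longrightarrow> x \<in> V" by auto
  have "successively (\<lambda>a b. \<phi> a < \<phi> b) ps"
    using ps(1) by (rule successively_mono) (use assms(2) in auto)
  then have "sorted_wrt (\<lambda>a b. \<phi> a < \<phi> b) ps"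
    by (rule successively_conv_sorted_wrt[THEN iffD1, rotated]) (auto simp: transp_def)
  then show "distinct ps" by (induction ps) auto
qed

lemma walks_first_step:
  assumes "a \<in> V"
  shows "walks E V a b =
    (if a = b then {[a]} else {}) \<union> (\<Union>c\<in>{c \<in> V. E a c}. (#) a ` walks E V c b)"
    (is "_ = ?R")
proof (intro equalityI subsetI)
  fix ps assume "ps \<in> walks E V a b"
  then obtain qs where ps: "ps = a # qs" "last (a # qs) = b" "successively E (a # qs)" "set qs \<subseteq> V"
    by (cases ps) (auto simp: walks_def)
  show "ps \<in> ?R"
  proof (cases qs)
    case (Cons c rs)
    then have "qs \<in> walks E V c b" "c \<in> V" "E a c" using ps by (auto simp: walks_def)
    then show ?thesis using ps(1) by auto
  qed (use ps in auto)
next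
  fix ps assume "ps \<in> ?R"
  then show "ps \<in> walks E V a b"
    using assms by (auto simp: walks_def successively_Cons split: if_splits)
qed

text \<open>Splitting off the first step. In matrix form this is W = 1 + A W, so the walk counts
  invert 1 - A.\<close>

lemma card_walks:
  fixes \<phi> :: "'a \<Rightarrow> nat"
  assumes "finite V" and "\<And>a b. E a b \<Longrightarrow> \<phi> a < \<phi> b" and "a \<in> V"
  shows "card (walks E V a b) =
    (if a = b then 1 else 0) + (\<Sum>c\<in>{c \<in> V. E a c}. card (walks E V c b))"
proof -
  have fin: "finite (walks E V c b)" for c by (rule finite_walks) fact+
  let ?U = "\<Union>c\<in>{c \<in> V. E a c}. (#) a ` walks E V c b"
  have "card (walks E V a b) = card (if a = b then {[a]} else {}) + card ?U"
    unfolding walks_first_step[OF assms(3), of E b] using fin assms(1)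
    by (intro card_Un_disjoint) (auto simp: walks_def)
  also have "card ?U = (\<Sum>c\<in>{c \<in> V. E a c}. card ((#) a ` walks E V c b))"
    using fin assms(1) by (intro card_UN_disjoint) (auto simp: walks_def)
  finally show ?thesis by (simp add: card_image)
qed

text \<open>\<open>x \<le> 2 * y\<close> is the line y = x/2 without fractions. The cut
  \<open>x < n\<close> makes the region finite.\<close>

definition schroeder_region :: "nat \<Rightarrow> (nat \<times> nat) set" where
  "schroeder_region n = {(x, y). y \<le> x \<and> x \<le> 2 * y \<and> x < n}"

lemma finite_schroeder_region [simp]: "finite (schroeder_region n)"
  by (rule finite_subset[of _ "{..<n} \<times> {..<n}"]) (auto simp: schroeder_region_def)

lemma schroeder_step_increases: "schroeder_step p q \<Longrightarrow> fst p + snd p < fst q + snd q"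
  by (auto simp: schroeder_step_def)

lemma not_schroeder_step_refl [simp]: "\<not> schroeder_step p p"
  using schroeder_step_increases by blast

text \<open>No step lowers the first coordinate, so a path that ends at \<open>(j, j)\<close> with
  \<open>j < n\<close> never meets the cut at \<open>n\<close>.\<close>

lemma schroeder_path_le_last:
  "successively schroeder_step ps \<Longrightarrow> p \<in> set ps \<Longrightarrow> fst p \<le> fst (last ps)"
proof (induction ps arbitrary: p)
  case (Cons q qs)
  show ?case
  proof (cases qs)
    case (Cons r rs)
    have "fst q \<le> fst r" using Cons.prems Cons by (auto simp: schroeder_step_def)
    moreover have IH: "fst s \<le> fst (last qs)" if "s \<in> set qs" for s
      using Cons.IH[OF _ that] Cons.prems Cons by simp
    moreover have "r \<in> set qs" using Cons by simp
    ultimately have "fst q \<le> fst (last qs)" by (meson order_trans)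
    then show ?thesis using Cons.prems(2) Cons IH[of p] by auto
  qed (use Cons.prems in auto)
qed simp

lemma modified_schroeder_paths_eq_walks:
  assumes "j < n"
  shows "modified_schroeder_paths i j = walks schroeder_step (schroeder_region n) (i, i) (j, j)"
  using schroeder_path_le_last assms
  by (fastforce simp: modified_schroeder_paths_def walks_def schroeder_region_def)

lemma modified_schroeder_eq_card_walks:
  assumes "j < n"
  shows "modified_schroeder i j =
    card (walks schroeder_step (schroeder_region n) (i, i) (j, j))"
proof (cases "i \<le> j")
  case False
  have "walks schroeder_step (schroeder_region n) (i, i) (j, j) = {}"
    using False schroeder_path_le_last by (fastforce simp: walks_def dest: hd_in_set)
  then show ?thesis using False by (simp add: modified_schroeder_def)
qed (simp add: modified_schroeder_def modified_schroeder_paths_eq_walks[OF assms])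

subsection \<open>The Kasteleyn matrix\<close>

text \<open>The Boolean selects the half of the pillow: \<open>True\<close> above the central line, \<open>False\<close> below.\<close>

type_synonym vertex = "bool \<times> nat \<times> nat"

definition pillow_vertices :: "nat \<Rightarrow> vertex set" where
  "pillow_vertices n = UNIV \<times> schroeder_region n"

text \<open>The diagonal points occupy the two central rows. Under \<open>i + j + 1 = n\<close> the
  odd cell of \<open>a\<close> and the even cell of \<open>b\<close> share a column, on opposite
  sides of the central line.\<close>

definition crossing_edge :: "nat \<Rightarrow> vertex \<Rightarrow> vertex \<Rightarrow> bool" where
  "crossing_edge n a b \<longleftrightarrow> fst a \<noteq> fst b \<and>
     (\<exists>i j. snd a = (i, i) \<and> snd b = (j, j) \<and> i + j + 1 = n)"

text \<open>Rows stand for odd cells and columns for even cells, both named by their reference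
  domino. The signs are chosen so that every nonzero term of the determinant equals 1.\<close>

definition kasteleyn :: "nat \<Rightarrow> vertex \<Rightarrow> vertex \<Rightarrow> int" where
  "kasteleyn n a b =
    (if a = b then 1
     else if fst a = fst b \<and> schroeder_step (snd a) (snd b) then - 1
     else if crossing_edge n a b then (if fst a then 1 else - 1) else 0)"

lemma finite_pillow_vertices [simp]: "finite (pillow_vertices n)"
  by (simp add: pillow_vertices_def)

text \<open>Multiplication on the right by \<open>G\<close>, the inverse of \<open>P\<close>, turns
  \<open>P + Z\<close> into the identity plus \<open>Z G\<close> and keeps the determinant. Only
  diagonal points have nonzero rows in \<open>Z\<close>; \<open>c\<close> lists them, the upper half
  first.\<close>

lemma det_kasteleyn_eq_center:
  fixes n :: nat
  defines "c \<equiv> \<lambda>i. if i < n then (True, (i, i)) else (False, (i - n, i - n))"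
  shows "det_on (pillow_vertices n) (kasteleyn n) =
    det_on (c ` {0..<2*n}) (\<lambda>a b. (if a = b then 1 else 0) +
      (\<Sum>d\<in>pillow_vertices n. (if crossing_edge n a d then (if fst a then 1 else - 1) else 0) *
        (if fst d = fst b then int (card (walks schroeder_step (schroeder_region n) (snd d) (snd b))) else 0)))"
    (is "_ = det_on ?C ?D")
proof -
  let ?V = "pillow_vertices n" and ?R = "schroeder_region n"
  define step :: "vertex \<Rightarrow> vertex \<Rightarrow> bool" where
    "step = (\<lambda>a b. fst a = fst b \<and> schroeder_step (snd a) (snd b))"
  define W where "W = (\<lambda>a b. int (card (walks schroeder_step ?R a b)))"
  define P where "P = (\<lambda>(a :: vertex) b. (if a = b then 1 else 0) - (if step a b then 1 else (0::int)))"
  define Z where "Z = (\<lambda>a b. if crossing_edge n a b then (if fst a then 1 else - 1) else (0::int))"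
  define G where "G = (\<lambda>(a :: vertex) (b :: vertex). if fst a = fst b then W (snd a) (snd b) else (0::int))"
  have step_neq: "step a b \<Longrightarrow> a \<noteq> b" for a b
    using schroeder_step_increases by (fastforce simp: step_def)
  have K: "kasteleyn n a b = P a b + Z a b" for a b
    using step_neq[of a b] by (auto simp: kasteleyn_def P_def Z_def step_def crossing_edge_def)
  have PG: "(\<Sum>d\<in>?V. P a d * G d b) = (if a = b then 1 else 0)" if aV: "a \<in> ?V" for a b
  proof -
    obtain h p where a: "a = (h, p)" "p \<in> ?R" using aV by (cases a) (auto simp: pillow_vertices_def)
    obtain h' q where b: "b = (h', q)" by (cases b)
    have "(\<Sum>d\<in>?V. P a d * G d b) =
        (\<Sum>d\<in>?V. (if a = d then G d b else 0)) - (\<Sum>d\<in>?V. (if step a d then G d b else 0))"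
      by (simp add: P_def left_diff_distrib sum_subtractf if_distrib[of "\<lambda>x. x * _"] cong: if_cong)
    also have "(\<Sum>d\<in>?V. (if a = d then G d b else 0)) = G a b"
      using that by simp
    also have "(\<Sum>d\<in>?V. (if step a d then G d b else 0)) =
        (\<Sum>d\<in>Pair h ` {c \<in> ?R. schroeder_step p c}. G d b)"
      by (intro sum.mono_neutral_cong_right) (auto simp: step_def a pillow_vertices_def)
    also have "\<dots> = (if h = h' then (\<Sum>c\<in>{c \<in> ?R. schroeder_step p c}. W c q) else 0)"
      by (subst sum.reindex) (auto simp: G_def b inj_on_def)
    also have "G a b = (if h = h' then W p q else 0)" by (simp add: G_def a b)
    also have "W p q = (if p = q then 1 else 0) + (\<Sum>c\<in>{c \<in> ?R. schroeder_step p c}. W c q)"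
      unfolding W_def using card_walks[OF finite_schroeder_region schroeder_step_increases a(2)]
      by simp
    finally show ?thesis by (auto simp: a b)
  qed
  have det_P: "det_on ?V P = 1"
    by (rule det_on_acyclic[where \<phi> = "\<lambda>a. fst (snd a) + snd (snd a)"])
       (use schroeder_step_increases step_neq in \<open>auto simp: P_def step_def split: if_splits\<close>)
  have "1 = det_on ?V (\<lambda>a b. if a = b then 1 else (0 :: int))"
    by (rule det_on_acyclic[symmetric, where \<phi> = "\<lambda>_. 0"]) (auto split: if_splits)
  also have "\<dots> = det_on ?V (\<lambda>a b. \<Sum>d\<in>?V. P a d * G d b)"
    by (rule det_on_cong) (simp add: PG)
  also have "\<dots> = det_on ?V G" by (simp add: det_on_mult det_P)
  finally have det_G: "det_on ?V G = 1" ..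
  have "det_on ?V (kasteleyn n) = det_on ?V (\<lambda>a b. \<Sum>d\<in>?V. kasteleyn n a d * G d b)"
    by (simp add: det_on_mult det_G)
  also have "\<dots> = det_on ?V ?D"
    by (rule det_on_cong)
       (simp add: K distrib_right sum.distrib PG, simp add: Z_def G_def W_def cong: if_cong)
  also have "\<dots> = det_on ?C ?D"
  proof (rule det_on_identity_rows)
    show "?C \<subseteq> ?V" by (auto simp: c_def pillow_vertices_def schroeder_region_def)
    fix a b assume a: "a \<in> ?V - ?C" "b \<in> ?V"
    have "\<not> crossing_edge n a d" for d
    proof
      assume "crossing_edge n a d"
      then obtain h i where "a = (h, (i, i))" "i < n"
        by (cases a) (auto simp: crossing_edge_def)
      then have "a = c (if h then i else n + i)" "(if h then i else n + i) \<in> {0..<2*n}"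
        by (auto simp: c_def)
      then show False using a by blast
    qed
    then show "?D a b = (if a = b then 1 else 0)" by simp
  qed simp
  finally show ?thesis .
qed

section \<open>The exchange matrix and the reduction to a block determinant\<close>

lemma exchange_mat_mult_index:
  assumes "A \<in> carrier_mat n n" "i < n" "j < n"
  shows "(exchange_mat n * A) $$ (i, j) = A $$ (n - 1 - i, j)"
proof -
  have "(exchange_mat n * A) $$ (i, j) =
      (\<Sum>k = 0..<n. (if i + k + 1 = n then 1 else 0) * A $$ (k, j))"
    using assms by (simp add: exchange_mat_def scalar_prod_def)
  also have "\<dots> = (\<Sum>k = 0..<n. if k = n - 1 - i then A $$ (k, j) else 0)"
    by (intro sum.cong) (use assms in auto)
  also have "\<dots> = A $$ (n - 1 - i, j)" using assms by simp
  finally show ?thesis .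
qed

lemma exchange_mat_carrier [simp]: "exchange_mat n \<in> carrier_mat n n"
  by (simp add: exchange_mat_def)

lemma modified_schroeder_mat_carrier [simp]: "modified_schroeder_mat n \<in> carrier_mat n n"
  by (simp add: modified_schroeder_mat_def)

lemma dim_exchange_mat [simp]: "dim_row (exchange_mat n) = n" "dim_col (exchange_mat n) = n"
  by (simp_all add: exchange_mat_def)

lemma exchange_mat_square: "exchange_mat n * exchange_mat n = 1\<^sub>m n"
  by (rule eq_matI, subst exchange_mat_mult_index[OF exchange_mat_carrier])
     (auto simp: exchange_mat_def)

text \<open>The central points give the blocks I, JS, -JS, I, with determinant det (I + JSJS). Since
  J is its own inverse, conjugation by J turns this into det (I + S (JSJ)), which is the determinant
  of the block matrix sought because its lower blocks commute.\<close>

lemma det_kasteleyn: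
  "det_on (pillow_vertices n) (kasteleyn n) =
    det (four_block_mat
      (modified_schroeder_mat n) (1\<^sub>m n)
      (- 1\<^sub>m n) (exchange_mat n * modified_schroeder_mat n * exchange_mat n))"
proof -
  let ?R = "schroeder_region n"
  let ?S = "modified_schroeder_mat n" and ?J = "exchange_mat n" and ?I = "1\<^sub>m n :: int mat"
  let ?c = "\<lambda>i. if i < n then (True, (i, i)) else (False, (i - n, i - n))"
  define W where "W = (\<lambda>a b. int (card (walks schroeder_step ?R a b)))"
  define D where "D = (\<lambda>(a :: vertex) (b :: vertex). (if a = b then 1 else 0) +
      (\<Sum>d\<in>pillow_vertices n. (if crossing_edge n a d then (if fst a then 1 else - 1) else 0) *
        (if fst d = fst b then W (snd d) (snd b) else 0)))"
  have D: "D (h, (i, i)) (h', (j, j)) = (if (h, i) = (h', j) then 1 else 0) +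
      (if h = h' then 0 else (if h then 1 else - 1) * int (modified_schroeder (n - 1 - i) j))"
    if ij: "i < n" "j < n" for h h' i j
  proof -
    \<comment> \<open>The only crossing neighbour of the diagonal point \<open>(i, i)\<close> of
      half \<open>h\<close>. It selects row \<open>n - 1 - i\<close> of the Schroeder matrix, and
      this reversal of rows is the factor \<open>?J\<close>.\<close>
    let ?d = "(\<not> h, (n - 1 - i, n - 1 - i))"
    have "(\<Sum>d\<in>pillow_vertices n. (if crossing_edge n (h, (i, i)) d then (if fst (h, (i, i)) then 1 else - 1) else 0) *
        (if fst d = fst (h', (j, j)) then W (snd d) (snd (h', (j, j))) else 0)) =
        (\<Sum>d\<in>{?d}. (if h then 1 else - 1) * (if fst d = h' then W (snd d) (j, j) else 0))"
      using ij
      by (intro sum.mono_neutral_cong_right finite_pillow_vertices)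
         (auto simp: crossing_edge_def pillow_vertices_def schroeder_region_def)
    then show ?thesis
      using ij by (simp add: D_def W_def modified_schroeder_eq_card_walks[OF ij(2)])
  qed
  have inj: "bij_betw ?c {0..<2*n} (?c ` {0..<2*n})"
    by (auto simp: bij_betw_def inj_on_def split: if_splits)
  have JS: "(?J * ?S) $$ (i, j) = int (modified_schroeder (n - 1 - i) j)" if "i < n" "j < n" for i j
    using that by (simp add: exchange_mat_mult_index) (simp add: modified_schroeder_mat_def)
  have car: "?J * ?S \<in> carrier_mat n n" "?S * ?J \<in> carrier_mat n n"
    by (auto intro!: mult_carrier_mat[of _ n n _ n])
  have "det_on (pillow_vertices n) (kasteleyn n) = det_on (?c ` {0..<2*n}) D"
    unfolding D_def W_def by (rule det_kasteleyn_eq_center)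
  also have "\<dots> = det (mat (2*n) (2*n) (\<lambda>(i, j). D (?c i) (?c j)))"
    by (rule det_on_conv_det[OF inj])
  also have "mat (2*n) (2*n) (\<lambda>(i, j). D (?c i) (?c j)) = four_block_mat ?I (?J * ?S) (- (?J * ?S)) ?I"
    (is "?L = ?M")
  proof (rule eq_matI)
    show "dim_row ?L = dim_row ?M" "dim_col ?L = dim_col ?M"
      by (auto simp: exchange_mat_def modified_schroeder_mat_def)
    fix i j assume "i < dim_row ?M" "j < dim_col ?M"
    then have ij: "i < 2 * n" "j < 2 * n" by auto
    have "?L $$ (i, j) = D (?c i) (?c j)" using ij by simp
    also have "\<dots> = ?M $$ (i, j)"
      using ij car
      by (cases "i < n"; cases "j < n")
         (auto simp: D JS simp del: index_mult_mat)
    finally show "?L $$ (i, j) = ?M $$ (i, j)" .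
  qed
  also have "det ?M = det (?I * ?I - ?J * ?S * (- (?J * ?S)))"
    using car
    by (intro det_four_block_mat[where n = n])
       (simp_all add: left_mult_one_mat[of _ n n] right_mult_one_mat[of _ n n])
  also have "?J * ?S * (- (?J * ?S)) = - (?J * ?S * (?J * ?S))"
    by (intro uminus_mult_right_mat) (simp add: exchange_mat_def modified_schroeder_mat_def)
  also have "?I * ?I - - (?J * ?S * (?J * ?S)) = ?I + ?J * ?S * (?J * ?S)"
    using car by (intro eq_matI) auto
  also have "det \<dots> = det (?J * (?I + ?S * ?J * (?S * ?J)) * ?J)"
  proof (rule arg_cong[where f = det])
    have "?J * (?I + ?S * ?J * (?S * ?J)) * ?J = ?J * ?I * ?J + ?J * (?S * ?J * (?S * ?J)) * ?J"
      using car
      by (simp add: mult_add_distrib_mat[of _ n n _ n] add_mult_distrib_mat[of _ n n _ _ n]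
          mult_carrier_mat[of _ n n _ n])
    also have "?J * (?S * ?J * (?S * ?J)) * ?J = ?J * ?S * (?J * ?S) * (?J * ?J)"
      by (simp add: assoc_mult_mat[of _ n n _ n _ n] mult_carrier_mat[of _ n n _ n])
    finally show "?I + ?J * ?S * (?J * ?S) = ?J * (?I + ?S * ?J * (?S * ?J)) * ?J"
      by (simp add: exchange_mat_square mult_carrier_mat[of _ n n _ n] right_mult_one_mat[of _ n n])
  qed
  also have "\<dots> = det (?I + ?S * ?J * (?S * ?J)) * det (?J * ?J)"
    using car by (simp add: det_mult[of _ n] mult_carrier_mat[of _ n n _ n])
  also have "\<dots> = det (?S * (?J * ?S * ?J) - ?I * (- ?I))"
  proof -
    have "?S * (?J * ?S * ?J) = ?S * ?J * (?S * ?J)"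
      by (simp add: assoc_mult_mat[of _ n n _ n _ n] mult_carrier_mat[of _ n n _ n])
    moreover have "Q - ?I * (- ?I) = ?I + Q" if "Q \<in> carrier_mat n n" for Q
      using that by (intro eq_matI) auto
    ultimately show ?thesis
      using car by (simp add: exchange_mat_square mult_carrier_mat[of _ n n _ n])
  qed
  also have "\<dots> = det (four_block_mat ?S ?I (- ?I) (?J * ?S * ?J))"
    by (intro det_four_block_mat[symmetric, where n = n])
       (simp_all add: mult_carrier_mat[of _ n n _ n] left_mult_one_mat[of _ n n]
         right_mult_one_mat[of _ n n])
  finally show ?thesis .
qed

subsection \<open>Tilings as permutations\<close>

text \<open>
  A point \<open>(x, y)\<close> of the Schroeder region lies \<open>x - y\<close> rows above the central one, and \<open>x + y\<close> is
  its position along the row; the lower half is the image under the rotation by a half turn. A cell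
  is even if the sum of its coordinates has the parity of \<open>n\<close>.
\<close>

definition even_cell :: "nat \<Rightarrow> vertex \<Rightarrow> cell" where
  "even_cell n = (\<lambda>(h, x, y).
     let c = (int x + int y - int n, int x - int y) in if h then c else (- 1 - fst c, - 1 - snd c))"

text \<open>The partner of the even cell in the reference tiling. It lies to the right in the upper
  half and, by the half turn, to the left in the lower half.\<close>

definition odd_cell :: "nat \<Rightarrow> vertex \<Rightarrow> cell" where
  "odd_cell n a = (fst (even_cell n a) + (if fst a then 1 else - 1), snd (even_cell n a))"

lemma even_cell_simps [simp]:
  "even_cell n (True, x, y) = (int x + int y - int n, int x - int y)"
  "even_cell n (False, x, y) = (int n - int x - int y - 1, int y - int x - 1)"
  by (simp_all add: even_cell_def)

lemma odd_cell_simps [simp]: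
  "odd_cell n (True, x, y) = (int x + int y - int n + 1, int x - int y)"
  "odd_cell n (False, x, y) = (int n - int x - int y - 2, int y - int x - 1)"
  by (simp_all add: odd_cell_def)

lemma in_pillow_vertices [simp]:
  "(h, x, y) \<in> pillow_vertices n \<longleftrightarrow> y \<le> x \<and> x \<le> 2 * y \<and> x < n"
  by (simp add: pillow_vertices_def schroeder_region_def)

lemma vertex_cases [case_names upper lower]:
  fixes a :: vertex
  obtains x y where "a = (True, x, y)" | x y where "a = (False, x, y)"
  by (cases a) auto

lemma inj_on_even_cell: "inj_on (even_cell n) (pillow_vertices n)"
proof (rule inj_onI)
  fix a b assume "a \<in> pillow_vertices n" "b \<in> pillow_vertices n" "even_cell n a = even_cell n b"
  then show "a = b" by (cases a rule: vertex_cases; cases b rule: vertex_cases) auto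
qed

lemma inj_on_odd_cell: "inj_on (odd_cell n) (pillow_vertices n)"
proof (rule inj_onI)
  fix a b assume "a \<in> pillow_vertices n" "b \<in> pillow_vertices n" "odd_cell n a = odd_cell n b"
  then show "a = b" by (cases a rule: vertex_cases; cases b rule: vertex_cases) auto
qed

lemma parity_even_cell: "even (fst (even_cell n a) + snd (even_cell n a) + int n)"
  by (cases a rule: vertex_cases) auto

lemma parity_odd_cell: "odd (fst (odd_cell n a) + snd (odd_cell n a) + int n)"
  by (cases a rule: vertex_cases) auto

text \<open>Going up, an upper row begins three cells further right and ends one cell further left
  than the row before. In the lower half the half turn exchanges the two slopes.\<close>

definition row_start :: "nat \<Rightarrow> int \<Rightarrow> int" where
  "row_start n b = (if b \<ge> 0 then 3 * b - int n else - int n - 1 - b)"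

definition row_end :: "nat \<Rightarrow> int \<Rightarrow> int" where
  "row_end n b = (if b \<ge> 0 then int n - 1 - b else int n + 2 + 3 * b)"

text \<open>The corners with extreme \<open>x + y\<close> and \<open>3 * y - x\<close> give four
  bounds on \<open>a\<close>; the sign of \<open>b\<close> decides which two of them are
  binding.\<close>

lemma in_aztec_pillow_iff:
  "(a, b) \<in> aztec_pillow n \<longleftrightarrow> row_start n b \<le> a \<and> a \<le> row_end n b"
proof -
  have "(a, b) \<in> aztec_pillow n \<longleftrightarrow> a + b \<le> int n - 1 \<and> - int n - 1 \<le> a + b \<and>
      3 * b - a \<le> int n \<and> - int n - 2 \<le> 3 * b - a"
    unfolding aztec_pillow_def vertices_def by (simp add: abs_le_iff) presburger
  then show ?thesis by (auto simp: row_start_def row_end_def)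
qed

text \<open>In the coordinates of the region, the left slope \<open>3 * b - n \<le> a\<close>
  becomes \<open>x \<le> 2 * y\<close>, the right one becomes \<open>x < n\<close>, and
  \<open>b \<ge> 0\<close> becomes \<open>y \<le> x\<close>, for both cells of a reference domino in
  the upper half.\<close>

lemma aztec_pillow_eq:
  "aztec_pillow n = odd_cell n ` pillow_vertices n \<union> even_cell n ` pillow_vertices n"
proof (intro equalityI subsetI)
  fix c assume c: "c \<in> aztec_pillow n"
  obtain a b where ab: "c = (a, b)" by (cases c)
  have bd: "row_start n b \<le> a" "a \<le> row_end n b"
    using c by (auto simp: ab in_aztec_pillow_iff)
  define h where "h \<longleftrightarrow> b \<ge> 0"
  \<comment> \<open>Cells are named by their lower left corners, so the half turn takes
    \<open>(a, b)\<close> to \<open>(- 1 - a, - 1 - b)\<close>. It moves a cell of the lower half to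
    the upper one.\<close>
  define a' b' where "a' = (if h then a else - 1 - a)" and "b' = (if h then b else - 1 - b)"
  have bd': "0 \<le> b'" "3 * b' - int n \<le> a'" "a' \<le> int n - 1 - b'"
    using bd by (auto simp: a'_def b'_def h_def row_start_def row_end_def)
  show "c \<in> odd_cell n ` pillow_vertices n \<union> even_cell n ` pillow_vertices n"
  proof (cases "even (a' + b' + int n)")
    case True
    then obtain k where k: "a' + b' + int n = 2 * k" by (elim evenE)
    have "k \<ge> 0" "k - b' \<ge> 0" using k bd' by linarith+
    then have "c = even_cell n (h, nat k, nat (k - b'))" "(h, nat k, nat (k - b')) \<in> pillow_vertices n"
      using k bd' by (cases h; auto simp: ab a'_def b'_def)+
    then show ?thesis by blast
  next
    case False
    then obtain k where k: "a' + b' + int n = 2 * k + 1" by (elim oddE)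
    have "k \<ge> 0" "k - b' \<ge> 0" using k bd' by linarith+
    then have "c = odd_cell n (h, nat k, nat (k - b'))" "(h, nat k, nat (k - b')) \<in> pillow_vertices n"
      using k bd' by (cases h; auto simp: ab a'_def b'_def)+
    then show ?thesis by blast
  qed
next
  fix c assume "c \<in> odd_cell n ` pillow_vertices n \<union> even_cell n ` pillow_vertices n"
  then obtain a where "a \<in> pillow_vertices n" "c = odd_cell n a \<or> c = even_cell n a" by auto
  then show "c \<in> aztec_pillow n"
    by (cases a rule: vertex_cases) (auto simp: in_aztec_pillow_iff row_start_def row_end_def)
qed

section \<open>Domino tilings as perfect matchings between the two colours\<close>

lemma is_domino_pair_iff:
  "is_domino {(x, y), (x', y')} \<longleftrightarrow> y = y' \<and> \<bar>x - x'\<bar> = 1 \<or> x = x' \<and> \<bar>y - y'\<bar> = 1"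
proof
  assume "is_domino {(x, y), (x', y')}"
  then show "y = y' \<and> \<bar>x - x'\<bar> = 1 \<or> x = x' \<and> \<bar>y - y'\<bar> = 1"
    by (auto simp: is_domino_def doubleton_eq_iff)
next
  assume "y = y' \<and> \<bar>x - x'\<bar> = 1 \<or> x = x' \<and> \<bar>y - y'\<bar> = 1"
  then consider "y = y'" "x' = x + 1" | "y = y'" "x = x' + 1" | "x = x'" "y' = y + 1" | "x = x'" "y = y' + 1"
    by linarith
  then show "is_domino {(x, y), (x', y')}"
    by cases (auto simp: is_domino_def doubleton_eq_iff)
qed

lemma domino_cells:
  assumes "is_domino d"
  obtains c c' where "d = {c, c'}" "odd (fst c + snd c + k)" "even (fst c' + snd c' + k)"
proof -
  obtain a b where "d = {(a, b), (a + 1, b)} \<or> d = {(a, b), (a, b + 1)}"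
    using assms by (auto simp: is_domino_def)
  then obtain u v where uv: "d = {u, v}" "fst v + snd v = fst u + snd u + 1"
    by fastforce
  show ?thesis
  proof (cases "odd (fst u + snd u + k)")
    case True
    then show ?thesis using that[of u v] uv by simp
  next
    case False
    then show ?thesis using that[of v u] uv by (simp add: insert_commute)
  qed
qed

text \<open>Every domino has one cell of each colour. Sending \<open>a\<close> to the label of the
  even cell that shares a domino with \<open>f a\<close> is therefore a bijection of
  \<open>V\<close>, and the tiling can be read back from it.\<close>

lemma card_domino_tilings:
  fixes f g :: "'a \<Rightarrow> cell"
  assumes fin: "finite V" and f: "inj_on f V" and g: "inj_on g V"
    and odd: "\<And>a. a \<in> V \<Longrightarrow> odd (fst (f a) + snd (f a) + k)"
    and even: "\<And>a. a \<in> V \<Longrightarrow> even (fst (g a) + snd (g a) + k)"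
  shows "card (domino_tilings (f ` V \<union> g ` V)) =
    card {p. p permutes V \<and> (\<forall>a\<in>V. is_domino {f a, g (p a)})}"
proof -
  let ?A = "{p. p permutes V \<and> (\<forall>a\<in>V. is_domino {f a, g (p a)})}"
  let ?T = "domino_tilings (f ` V \<union> g ` V)"
  define \<Phi> where "\<Phi> p = (\<lambda>a. {f a, g (p a)}) ` V" for p
  have fg: "f a \<noteq> g b" if "a \<in> V" "b \<in> V" for a b using odd even that by metis
  have feq: "f a = f b \<longleftrightarrow> a = b" if "a \<in> V" "b \<in> V" for a b
    using f that by (auto simp: inj_on_def)
  have geq: "g a = g b \<longleftrightarrow> a = b" if "a \<in> V" "b \<in> V" for a b
    using g that by (auto simp: inj_on_def)
  have "bij_betw \<Phi> ?A ?T"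
    unfolding bij_betw_def
  proof (intro conjI equalityI subsetI)
    show "inj_on \<Phi> ?A"
    proof (rule inj_onI, rule ext)
      fix p q a assume pq: "p \<in> ?A" "q \<in> ?A" "\<Phi> p = \<Phi> q"
      then have p: "p permutes V" and q: "q permutes V" by auto
      show "p a = q a"
      proof (cases "a \<in> V")
        case True
        then have "{f a, g (p a)} \<in> \<Phi> q" using pq(3) by (auto simp: \<Phi>_def)
        then obtain b where b: "b \<in> V" "{f a, g (p a)} = {f b, g (q b)}" by (auto simp: \<Phi>_def)
        have "p a \<in> V" "q b \<in> V" using p q True b(1) by (auto simp: permutes_in_image)
        then show ?thesis using b True by (auto simp: doubleton_eq_iff feq geq fg)
      qed (use p q in \<open>simp add: permutes_not_in\<close>)
    qed
  next
    fix T assume "T \<in> \<Phi> ` ?A"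
    then obtain p where p: "p permutes V" "\<And>a. a \<in> V \<Longrightarrow> is_domino {f a, g (p a)}" "T = \<Phi> p"
      by auto
    have pV: "p a \<in> V" if "a \<in> V" for a using p(1) that by (simp add: permutes_in_image)
    have peq: "p a = p b \<longleftrightarrow> a = b" for a b using permutes_inj[OF p(1)] by (auto simp: inj_def)
    have "pairwise disjnt T"
      unfolding p(3) \<Phi>_def pairwise_image
      by (auto simp: pairwise_def disjnt_def feq geq fg fg[symmetric] pV peq)
    moreover have "\<Union>T = f ` V \<union> g ` p ` V" by (auto simp: p(3) \<Phi>_def)
    ultimately show "T \<in> ?T"
      using p by (auto simp: domino_tilings_def \<Phi>_def permutes_image)
  next
    fix T assume "T \<in> ?T"
    then have dom: "\<And>d. d \<in> T \<Longrightarrow> is_domino d" and disj: "pairwise disjnt T"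
      and Un: "\<Union>T = f ` V \<union> g ` V" by (auto simp: domino_tilings_def)
    have uniq: "d = d'" if "d \<in> T" "d' \<in> T" "c \<in> d" "c \<in> d'" for c d d'
      using disj that by (auto simp: pairwise_def disjnt_def)
    have form: "\<exists>a\<in>V. \<exists>b\<in>V. d = {f a, g b}" if dT: "d \<in> T" for d
    proof -
      obtain c c' where c: "d = {c, c'}" "odd (fst c + snd c + k)" "even (fst c' + snd c' + k)"
        using domino_cells[OF dom[OF dT]] by metis
      have "c \<in> f ` V \<union> g ` V" "c' \<in> f ` V \<union> g ` V" using Un dT c(1) by auto
      then have "c \<in> f ` V" "c' \<in> g ` V" using c(2,3) odd even by blast+
      then show ?thesis using c(1) by blast
    qed
    have "\<exists>b\<in>V. {f a, g b} \<in> T" if a: "a \<in> V" for a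
    proof -
      have "f a \<in> \<Union>T" using a Un by blast
      then obtain d where d: "d \<in> T" "f a \<in> d" by blast
      then obtain a' b where "a' \<in> V" "b \<in> V" "d = {f a', g b}" using form by blast
      then show ?thesis using d a fg feq by auto
    qed
    then obtain q where q: "\<And>a. a \<in> V \<Longrightarrow> q a \<in> V" "\<And>a. a \<in> V \<Longrightarrow> {f a, g (q a)} \<in> T"
      by metis
    have "inj_on q V"
    proof (rule inj_onI)
      fix a b assume ab: "a \<in> V" "b \<in> V" "q a = q b"
      then have "{f a, g (q a)} = {f b, g (q b)}" using q(2)[OF ab(1)] q(2)[OF ab(2)] by (intro uniq[of _ _ "g (q a)"]) auto
      then show "a = b" using ab fg q(1) feq by (auto simp: doubleton_eq_iff)
    qed
    moreover have "q ` V = V" using \<open>inj_on q V\<close> q(1) fin by (intro endo_inj_surj) auto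
    ultimately have "bij_betw q V V" by (simp add: bij_betw_def)
    define p where "p = restrict_id q V"
    have p: "p permutes V" unfolding p_def by (rule permutes_restrict_id) fact
    have pq: "p a = q a" if "a \<in> V" for a using that by (simp add: p_def)
    have "T = \<Phi> p"
    proof (intro equalityI subsetI)
      fix d assume d: "d \<in> T"
      then obtain a b where ab: "a \<in> V" "d = {f a, g b}" using form by blast
      then have "d = {f a, g (q a)}" using q(2) d by (intro uniq[of _ _ "f a"]) auto
      then show "d \<in> \<Phi> p" using ab(1) pq by (auto simp: \<Phi>_def)
    qed (use q(2) pq in \<open>auto simp: \<Phi>_def\<close>)
    moreover have "p \<in> ?A" using p q(2) dom pq by auto
    ultimately show "T \<in> \<Phi> ` ?A" by blast
  qed
  then show ?thesis by (simp add: bij_betw_same_card)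
qed

text \<open>In the upper half the even cells around the odd cell of \<open>(x, y)\<close> are those
  of \<open>(x, y)\<close> on the left, \<open>(x + 1, y)\<close> above, \<open>(x, y + 1)\<close>
  below and \<open>(x + 1, y + 1)\<close> on the right; below a diagonal point the other half
  begins. The lower half is the rotated picture.\<close>

lemma is_domino_cells_iff:
  assumes "a \<in> pillow_vertices n" "b \<in> pillow_vertices n"
  shows "is_domino {odd_cell n a, even_cell n b} \<longleftrightarrow>
    a = b \<or> fst a = fst b \<and> schroeder_step (snd a) (snd b) \<or> crossing_edge n a b"
  using assms
  using assms
  by (cases a rule: vertex_cases; cases b rule: vertex_cases)
     (auto simp: is_domino_pair_iff schroeder_step_def crossing_edge_def)

lemma kasteleyn_nonzero_iff:
  assumes "a \<in> pillow_vertices n" "b \<in> pillow_vertices n"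
  shows "kasteleyn n a b \<noteq> 0 \<longleftrightarrow> is_domino {odd_cell n a, even_cell n b}"
  using assms by (auto simp: is_domino_cells_iff kasteleyn_def)

text \<open>The nonzero terms of the determinant are exactly those of permutations that come from
  tilings. That each of them equals 1 is the hypothesis \<open>sign\<close>, which the sign
  computation below discharges.\<close>

lemma card_tilings_eq_det:
  assumes sign: "\<And>p. p permutes pillow_vertices n \<Longrightarrow>
      (\<And>a. a \<in> pillow_vertices n \<Longrightarrow> is_domino {odd_cell n a, even_cell n (p a)}) \<Longrightarrow>
      sign p * (\<Prod>a\<in>pillow_vertices n. kasteleyn n a (p a)) = 1"
  shows "int (card (domino_tilings (aztec_pillow n))) = det_on (pillow_vertices n) (kasteleyn n)"
proof -
  let ?V = "pillow_vertices n"
  let ?A = "{p. p permutes ?V \<and> (\<forall>a\<in>?V. is_domino {odd_cell n a, even_cell n (p a)})}"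
  have zero: "(\<Prod>a\<in>?V. kasteleyn n a (p a)) = 0" if p: "p permutes ?V" "p \<notin> ?A" for p
  proof -
    obtain a where "a \<in> ?V" "\<not> is_domino {odd_cell n a, even_cell n (p a)}" using p by auto
    then have "kasteleyn n a (p a) = 0"
      using kasteleyn_nonzero_iff[of a n "p a"] p(1) by (auto simp: permutes_in_image)
    then show ?thesis using \<open>a \<in> ?V\<close> by (intro prod_zero) auto
  qed
  have "det_on ?V (kasteleyn n) = (\<Sum>p\<in>?A. sign p * (\<Prod>a\<in>?V. kasteleyn n a (p a)))"
    unfolding det_on_def using zero
    by (intro sum.mono_neutral_cong_right) (auto simp: finite_permutations)
  also have "\<dots> = (\<Sum>p\<in>?A. 1)" using sign by (intro sum.cong) auto
  also have "\<dots> = int (card ?A)" by simp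
  also have "card ?A = card (domino_tilings (aztec_pillow n))"
    unfolding aztec_pillow_eq
    by (rule card_domino_tilings[symmetric, where k = "int n"])
       (rule finite_pillow_vertices inj_on_even_cell inj_on_odd_cell parity_even_cell parity_odd_cell)+
  finally show ?thesis by simp
qed

subsection \<open>The sign of a tiling\<close>

text \<open>A pair \<open>f a\<close>, \<open>g a\<close> inside \<open>Q\<close> contributes 2, so
  only the pairs that \<open>Q\<close> separates matter modulo 2.\<close>

lemma even_card_iff_split:
  assumes fin: "finite V" and f: "inj_on f V" and g: "inj_on g V"
    and fg: "\<And>a b. a \<in> V \<Longrightarrow> b \<in> V \<Longrightarrow> f a \<noteq> g b" and Q: "Q \<subseteq> f ` V \<union> g ` V"
  shows "even (card Q) \<longleftrightarrow> even (card {a \<in> V. (f a \<in> Q) \<noteq> (g a \<in> Q)})"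
proof -
  let ?F = "{a \<in> V. f a \<in> Q}" and ?G = "{a \<in> V. g a \<in> Q}"
  have Q_eq: "Q = f ` ?F \<union> g ` ?G" using Q by auto
  have "card (f ` ?F \<union> g ` ?G) = card (f ` ?F) + card (g ` ?G)"
    using fin fg by (intro card_Un_disjoint) auto
  then have "card Q = card (f ` ?F) + card (g ` ?G)" using Q_eq by simp
  also have "card (f ` ?F) = card ?F" using f by (intro card_image) (auto simp: inj_on_def)
  also have "card (g ` ?G) = card ?G" using g by (intro card_image) (auto simp: inj_on_def)
  finally have 1: "card Q = card ?F + card ?G" .
  have "card ?F = card (?F - ?G) + card (?F \<inter> ?G)" "card ?G = card (?G - ?F) + card (?F \<inter> ?G)"
    using fin card_Int_Diff[of ?F ?G] card_Int_Diff[of ?G ?F] by (auto simp: Int_commute)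
  moreover have "card ((?F - ?G) \<union> (?G - ?F)) = card (?F - ?G) + card (?G - ?F)"
    using fin by (intro card_Un_disjoint) auto
  moreover have "(?F - ?G) \<union> (?G - ?F) = {a \<in> V. (f a \<in> Q) \<noteq> (g a \<in> Q)}" by auto
  ultimately have "card Q = card {a \<in> V. (f a \<in> Q) \<noteq> (g a \<in> Q)} + 2 * card (?F \<inter> ?G)"
    using 1 by simp
  then show ?thesis by simp
qed

text \<open>The components are swapped because the lexicographic order looks at the first one first:
  cells are read row by row, from left to right.\<close>

definition row_key :: "cell \<Rightarrow> int \<times> int" where
  "row_key c = (snd c, fst c)"

lemma row_key_less [simp]:
  "row_key c < row_key d \<longleftrightarrow> snd c < snd d \<or> snd c = snd d \<and> fst c < fst d"
  by (auto simp: row_key_def less_prod_def)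

lemma row_key_eq [simp]: "row_key c = row_key d \<longleftrightarrow> c = d"
  by (auto simp: row_key_def prod_eq_iff)

text \<open>Neighbours in a row are consecutive in the reading order, so no other cell comes between
  them.\<close>

lemma crossing_sign_horizontal:
  assumes "snd u = snd u'" "\<bar>fst u - fst u'\<bar> = 1" "v \<notin> {u, u'}" "v' \<notin> {u, u'}"
  shows "crossing_sign row_key u u' v v' = 1"
proof -
  have "order_sign (row_key u) (row_key w) = order_sign (row_key u') (row_key w)"
    if "w \<notin> {u, u'}" for w
  proof -
    have "fst w \<noteq> fst u \<and> fst w \<noteq> fst u' \<or> snd w \<noteq> snd u"
      using that assms(1) by (auto simp: prod_eq_iff)
    then show ?thesis using assms(1,2) by (auto simp: order_sign_def)
  qed
  then have eq: "order_sign (row_key u) (row_key v) = order_sign (row_key u') (row_key v)"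
    "order_sign (row_key u) (row_key v') = order_sign (row_key u') (row_key v')"
    using assms(3,4) by auto
  show ?thesis unfolding crossing_sign_def eq by (simp add: mult_ac flip: mult.assoc)
qed

section \<open>Local signs of dominoes\<close>

definition upper_cell :: "cell \<Rightarrow> cell \<Rightarrow> cell" where
  "upper_cell c d = (if snd c < snd d then d else c)"

text \<open>A gauge factor: its contributions cancel over a permutation, since every vertex serves
  once as a row and once as a column.\<close>

definition row_sign :: "vertex \<Rightarrow> int" where
  "row_sign a = (if even (fst (snd a) + snd (snd a)) then 1 else - 1)"

lemma row_sign_square [simp]: "row_sign a * row_sign a = 1"
  by (simp add: row_sign_def)

text \<open>
  For a vertical domino the second factor is the parity of the number of later dominoes that
  interleave with it; see \<open>even_later_crossings\<close> below.
\<close>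

definition domino_sign :: "nat \<Rightarrow> cell \<Rightarrow> cell \<Rightarrow> int" where
  "domino_sign n c d = order_sign (row_key c) (row_key d) *
     (if fst c = fst d
      then if even (fst c - row_start n (snd (upper_cell c d))) then - 1 else 1
      else 1)"

lemma domino_sign_horizontal:
  "domino_sign n (x, y) (x + 1, y) = 1" "domino_sign n (x, y) (x - 1, y) = - 1"
  by (simp_all add: domino_sign_def order_sign_def)

text \<open>The first cell of a row is an even cell in the upper half and an odd one in the lower
  half.\<close>

lemma row_start_parity:
  "even (x - row_start n y) \<longleftrightarrow> (y \<ge> 0 \<longleftrightarrow> even (x + y + int n))"
  by (auto simp: row_start_def)

lemma domino_sign_vertical:
  "domino_sign n (x, y) (x, y + 1) = (if y + 1 \<ge> 0 \<longleftrightarrow> odd (x + y + int n) then - 1 else 1)"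
  "domino_sign n (x, y) (x, y - 1) = (if y \<ge> 0 \<longleftrightarrow> even (x + y + int n) then 1 else - 1)"
  by (simp_all only: domino_sign_def order_sign_def upper_cell_def row_start_parity) auto

text \<open>The local Kasteleyn condition: relative to the reference domino, the sign of a domino
  cancels its matrix entry up to the gauge factor. The cases run through the neighbours of an odd
  cell.\<close>

lemma domino_sign_kasteleyn:
  assumes "a \<in> pillow_vertices n" "b \<in> pillow_vertices n"
    and "is_domino {odd_cell n a, even_cell n b}"
  shows "domino_sign n (odd_cell n a) (even_cell n b) *
      order_sign (row_key (odd_cell n a)) (row_key (even_cell n a)) * kasteleyn n a b =
    row_sign a * row_sign b"
proof -
  obtain h x y where a: "a = (h, x, y)" by (cases a)
  define s t where "s = int x + int y - int n" and "t = int x - int y"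
  define c where "c = odd_cell n a"
  have c: "c = (if h then (s + 1, t) else (- s - 2, - 1 - t))"
    by (simp add: c_def a s_def t_def)
  have ref: "order_sign (row_key c) (row_key (even_cell n a)) = (if h then - 1 else 1)"
    by (simp add: c_def a order_sign_def)
  have t: "t \<ge> 0" using assms(1) by (simp add: a t_def)
  have parity: "even (s + t + int n)" by (simp add: s_def t_def)
  from assms(3) consider "b = a" | "b = (h, x, y + 1)" | "b = (h, x + 1, y)" | "b = (h, x + 1, y + 1)"
    | j where "x = y" "b = (\<not> h, j, j)" "n = x + j + 1"
    using is_domino_cells_iff[OF assms(1,2)]
    by (cases b) (auto simp: a schroeder_step_def crossing_edge_def)
  then have "domino_sign n c (even_cell n b) * (if h then - 1 else 1) * kasteleyn n a b =
      row_sign a * row_sign b"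
  proof cases
    case 1
    have "even_cell n b = (if h then (fst c - 1, snd c) else (fst c + 1, snd c))"
      by (simp add: 1 a c s_def t_def)
    then show ?thesis
      using domino_sign_horizontal[of n "fst c" "snd c"] by (simp add: 1 kasteleyn_def)
  next
    case 2
    have "kasteleyn n a b = - 1" "row_sign a * row_sign b = - 1"
      by (simp_all add: a 2 kasteleyn_def schroeder_step_def row_sign_def)
    \<comment> \<open>This keeps the upper cell of a lower-half domino in a negative row. Where
      \<open>t = 0\<close>, the domino crosses the central line and its upper cell follows the other
      parity rule; that is the last case.\<close>
    moreover have "t \<ge> 1" using assms(2) by (simp add: 2 t_def)
    moreover have "even_cell n b = (if h then (fst c, snd c - 1) else (fst c, snd c + 1))"
      by (simp add: 2 c s_def t_def)
    ultimately show ?thesis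
      using domino_sign_vertical[of n "fst c" "snd c"] parity by (cases h) (auto simp: c)
  next
    case 3
    have "kasteleyn n a b = - 1" "row_sign a * row_sign b = - 1"
      by (simp_all add: a 3 kasteleyn_def schroeder_step_def row_sign_def)
    moreover have "even_cell n b = (if h then (fst c, snd c + 1) else (fst c, snd c - 1))"
      by (simp add: 3 c s_def t_def)
    ultimately show ?thesis
      using domino_sign_vertical[of n "fst c" "snd c"] parity t by (cases h) (auto simp: c)
  next
    case 4
    have "kasteleyn n a b = - 1" "row_sign a * row_sign b = 1"
      by (simp_all add: a 4 kasteleyn_def schroeder_step_def row_sign_def)
    moreover have "even_cell n b = (if h then (fst c + 1, snd c) else (fst c - 1, snd c))"
      by (simp add: 4 c s_def t_def)
    ultimately show ?thesis
      using domino_sign_horizontal[of n "fst c" "snd c"] by simp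
  next
    case 5
    have "kasteleyn n a b = (if h then 1 else - 1)" "row_sign a * row_sign b = 1"
      using 5 by (simp_all add: a kasteleyn_def crossing_edge_def row_sign_def)
    moreover have "even_cell n b = (if h then (fst c, snd c - 1) else (fst c, snd c + 1))" "t = 0"
      using 5 by (simp_all add: c s_def t_def)
    ultimately show ?thesis
      using domino_sign_vertical[of n "fst c" "snd c"] parity by (cases h) (auto simp: c)
  qed
  then show ?thesis using ref by (simp add: c_def)
qed

section \<open>Crossings within a fixed tiling\<close>

locale pillow_matching =
  fixes n :: nat and p :: "vertex \<Rightarrow> vertex"
  assumes permutes: "p permutes pillow_vertices n"
    and dominoes: "\<And>a. a \<in> pillow_vertices n \<Longrightarrow> is_domino {odd_cell n a, even_cell n (p a)}"
begin

abbreviation "V \<equiv> pillow_vertices n"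
abbreviation "f \<equiv> odd_cell n"
abbreviation "g \<equiv> \<lambda>a. even_cell n (p a)"
abbreviation "vertical a \<equiv> fst (f a) = fst (g a)"
abbreviation "upper a \<equiv> upper_cell (f a) (g a)"

definition lower :: "vertex \<Rightarrow> cell" where
  "lower a = (if snd (f a) < snd (g a) then f a else g a)"

lemma p_in [simp]: "p a \<in> V \<longleftrightarrow> a \<in> V"
  using permutes by (simp add: permutes_in_image)

lemma f_eq_iff: "a \<in> V \<Longrightarrow> b \<in> V \<Longrightarrow> f a = f b \<longleftrightarrow> a = b"
  using inj_on_odd_cell by (auto simp: inj_on_def)

lemma g_eq_iff: "a \<in> V \<Longrightarrow> b \<in> V \<Longrightarrow> g a = g b \<longleftrightarrow> a = b"
  by (simp add: inj_on_eq_iff[OF inj_on_even_cell] inj_eq[OF permutes_inj[OF permutes]])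

lemma inj_on_g: "inj_on g V"
  by (rule inj_onI) (simp add: g_eq_iff)

lemma odd_neq_even: "odd_cell n a \<noteq> even_cell n b"
  using parity_odd_cell[of n a] parity_even_cell[of n b] by metis

lemma cells: "f ` V \<union> g ` V = aztec_pillow n"
proof -
  have "g ` V = even_cell n ` p ` V" by (simp add: image_image)
  then show ?thesis by (simp add: aztec_pillow_eq permutes_image[OF permutes])
qed

lemma shape:
  assumes "a \<in> V"
  shows "snd (f a) = snd (g a) \<and> \<bar>fst (f a) - fst (g a)\<bar> = 1 \<or>
    vertical a \<and> \<bar>snd (f a) - snd (g a)\<bar> = 1"
  using dominoes[OF assms] is_domino_pair_iff[of "fst (f a)" "snd (f a)" "fst (g a)" "snd (g a)"]
  by simp

lemma lower_upper:
  assumes "a \<in> V" "vertical a"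
  shows "snd (lower a) = snd (upper a) - 1" "fst (lower a) = fst (f a)" "fst (upper a) = fst (f a)"
    "f a = upper a \<and> g a = lower a \<or> g a = upper a \<and> f a = lower a"
  using shape[OF assms(1)] assms(2) by (auto simp: upper_cell_def lower_def)

lemma cells_distinct:
  assumes "a \<in> V" "b \<in> V" "a \<noteq> b"
  shows "{f a, g a} \<inter> {f b, g b} = {}"
  using assms odd_neq_even odd_neq_even[symmetric] by (auto simp: f_eq_iff g_eq_iff)

lemma upper_lower_distinct:
  assumes "a \<in> V" "b \<in> V" "a \<noteq> b"
  shows "upper a \<noteq> upper b" "upper a \<noteq> lower b" "lower a \<noteq> lower b"
  using cells_distinct[OF assms] by (auto simp: upper_cell_def lower_def)

lemma crossing_sign_eq_1:
  assumes "a \<in> V" "b \<in> V" "a \<noteq> b" "\<not> (vertical a \<and> vertical b)"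
  shows "crossing_sign row_key (f a) (g a) (f b) (g b) = 1"
proof (cases "vertical a")
  case False
  then show ?thesis
    using shape[OF assms(1)] cells_distinct[OF assms(1-3)] by (intro crossing_sign_horizontal) auto
next
  case True
  then have "crossing_sign row_key (f b) (g b) (f a) (g a) = 1"
    using shape[OF assms(2)] cells_distinct[OF assms(1-3)] assms(4)
    by (intro crossing_sign_horizontal) auto
  then show ?thesis
    using cells_distinct[OF assms(1-3)]
    by (subst crossing_sign_swap) auto
qed

text \<open>Each vertical domino has its lower cell first, so when \<open>lower a\<close> precedes
  \<open>lower b\<close> there is just one way to interleave.\<close>

lemma crossing_sign_vertical:
  assumes "a \<in> V" "b \<in> V" "vertical a" "vertical b" "row_key (lower a) < row_key (lower b)"
  shows "crossing_sign row_key (f a) (g a) (f b) (g b) =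
    (if row_key (lower b) < row_key (upper a) \<and> row_key (upper a) < row_key (upper b) then - 1 else 1)"
proof -
  have "a \<noteq> b" using assms(5) by auto
  have "crossing_sign row_key (f a) (g a) (f b) (g b) =
      crossing_sign row_key (lower a) (upper a) (lower b) (upper b)"
    using lower_upper(4)[OF assms(1,3)] lower_upper(4)[OF assms(2,4)]
    by (auto simp: crossing_sign_commute)
  moreover have "upper a \<noteq> lower b" "upper a \<noteq> upper b"
    using upper_lower_distinct[OF assms(1,2) \<open>a \<noteq> b\<close>] by auto
  moreover have "row_key (lower a) < row_key (upper b)" "row_key (lower b) < row_key (upper b)"
    using assms(5) lower_upper(1)[OF assms(2,4)] by auto
  ultimately show ?thesis
    using assms(5) less_trans[of "row_key (upper a)" "row_key (lower b)" "row_key (upper b)"]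
    by (auto simp: crossing_sign_def order_sign_def simp del: row_key_less)
qed

text \<open>Each reference domino is horizontal, so it lies entirely inside or outside the rows from
  \<open>y\<close> upwards.\<close>

lemma even_rows_above: "even (card {c \<in> aztec_pillow n. y \<le> snd c})"
proof -
  let ?Q = "{c \<in> aztec_pillow n. y \<le> snd c}"
  have "even (card ?Q) \<longleftrightarrow> even (card {a \<in> V. (f a \<in> ?Q) \<noteq> (even_cell n a \<in> ?Q)})"
    using aztec_pillow_eq[of n]
    by (intro even_card_iff_split inj_on_odd_cell inj_on_even_cell odd_neq_even) auto
  moreover have "{a \<in> V. (f a \<in> ?Q) \<noteq> (even_cell n a \<in> ?Q)} = {}"
    by (auto simp: aztec_pillow_eq odd_cell_def)
  ultimately show ?thesis by (simp only: card.empty even_zero)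
qed

lemma even_card_iff_split':
  assumes "Q \<subseteq> aztec_pillow n"
  shows "even (card Q) \<longleftrightarrow> even (card {a \<in> V. (f a \<in> Q) \<noteq> (g a \<in> Q)})"
  using assms odd_neq_even
  by (intro even_card_iff_split) (auto simp: inj_on_odd_cell cells inj_on_g)

text \<open>The half-plane \<open>y \<le> snd c\<close> separates precisely these dominoes into
  their two cells, and it contains an even number of cells of the pillow.\<close>

lemma even_verticals:
  "even (card {b \<in> V. vertical b \<and> snd (upper b) = y})"
proof -
  let ?Q = "{c \<in> aztec_pillow n. y \<le> snd c}"
  have "{b \<in> V. (f b \<in> ?Q) \<noteq> (g b \<in> ?Q)} = {b \<in> V. vertical b \<and> snd (upper b) = y}"
  proof (intro Collect_cong conj_cong refl)
    fix b assume b: "b \<in> V"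
    then have "f b \<in> aztec_pillow n" "g b \<in> aztec_pillow n" using cells by auto
    then show "(f b \<in> ?Q) \<noteq> (g b \<in> ?Q) \<longleftrightarrow> vertical b \<and> snd (upper b) = y"
      using shape[OF b] by (auto simp: upper_cell_def)
  qed
  moreover have "even (card {b \<in> V. (f b \<in> ?Q) \<noteq> (g b \<in> ?Q)})"
    using even_rows_above[of y] by (subst even_card_iff_split'[symmetric]) auto
  ultimately show ?thesis by simp
qed

text \<open>Apply the splitting parity to the cells of row \<open>y\<close> to the left of
  \<open>upper a\<close>. This segment separates the vertical dominoes that have their upper or
  their lower cell in it, and no others.\<close>

lemma even_left_of_vertical:
  assumes a: "a \<in> V" "vertical a" and xy: "upper a = (x, y)"
  shows "even (x - row_start n y) \<longleftrightarrow>
    even (card {b \<in> V. vertical b \<and> snd (upper b) = y \<and> fst (f b) < x} +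
          card {b \<in> V. vertical b \<and> snd (upper b) = y + 1 \<and> fst (f b) < x})"
    (is "_ \<longleftrightarrow> even (card ?L + card ?U)")
proof -
  have top_in: "(x, y) \<in> aztec_pillow n"
    using lower_upper(4)[OF a] a(1) cells xy by (metis UnI1 UnI2 imageI)
  let ?Q = "{row_start n y..<x} \<times> {y}"
  have Q: "?Q \<subseteq> aztec_pillow n" using top_in by (auto simp: in_aztec_pillow_iff)
  have in_Q: "c \<in> ?Q \<longleftrightarrow> snd c = y \<and> fst c < x" if "c \<in> aztec_pillow n" for c
    using that by (cases c) (auto simp: in_aztec_pillow_iff)
  have "{b \<in> V. (f b \<in> ?Q) \<noteq> (g b \<in> ?Q)} = ?L \<union> ?U"
  proof (intro Set.set_eqI)
    fix b
    show "b \<in> {b \<in> V. (f b \<in> ?Q) \<noteq> (g b \<in> ?Q)} \<longleftrightarrow> b \<in> ?L \<union> ?U"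
    proof (cases "b \<in> V")
      case True
      then have "f b \<in> aztec_pillow n" "g b \<in> aztec_pillow n" using cells by auto
      note iff = in_Q[OF this(1)] in_Q[OF this(2)]
      show ?thesis
      proof (cases "vertical b")
        case True
        then show ?thesis using \<open>b \<in> V\<close> shape[OF \<open>b \<in> V\<close>] unfolding mem_Collect_eq iff
          by (auto simp: upper_cell_def)
      next
        case False
        \<comment> \<open>A horizontal domino cut by the right end of the segment would contain
          \<open>(x, y)\<close>, but that cell belongs to the domino of \<open>a\<close>.\<close>
        then have "a \<noteq> b" using a(2) by auto
        then have "f b \<noteq> (x, y)" "g b \<noteq> (x, y)"
          using cells_distinct[OF a(1) \<open>b \<in> V\<close>] lower_upper(4)[OF a] xy by auto
        then show ?thesis using \<open>b \<in> V\<close> False shape[OF \<open>b \<in> V\<close>] unfolding mem_Collect_eq iff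
          by (auto simp: prod_eq_iff)
      qed
    qed simp
  qed
  moreover have "card (?L \<union> ?U) = card ?L + card ?U"
    by (intro card_Un_disjoint) auto
  moreover have "card ?Q = nat (x - row_start n y)" by (simp add: card_cartesian_product)
  moreover have "row_start n y \<le> x" using top_in by (simp add: in_aztec_pillow_iff)
  ultimately show ?thesis using even_card_iff_split'[OF Q] by (simp add: even_nat_iff)
qed

text \<open>A later domino interleaves if its upper cell is in row \<open>y\<close> further right
  (\<open>R\<close>) or its lower cell is in row \<open>y\<close> further left (\<open>U\<close>).
  With \<open>L\<close> for upper cells further left, |L| + 1 + |R| is even, so \<open>R\<close> can
  be traded for \<open>L\<close> at the cost of one parity change, and |L| + |U| has the parity of
  the number of cells to the left of \<open>upper a\<close>.\<close>

lemma even_later_crossings: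
  assumes a: "a \<in> V" "vertical a"
  shows "even (card {b \<in> V. vertical b \<and> row_key (lower a) < row_key (lower b) \<and>
      row_key (lower b) < row_key (upper a) \<and> row_key (upper a) < row_key (upper b)}) \<longleftrightarrow>
    odd (fst (f a) - row_start n (snd (upper a)))"
proof -
  obtain x y where xy: "upper a = (x, y)" by (cases "upper a")
  have x: "fst (f a) = x" "fst (lower a) = x" "snd (lower a) = y - 1"
    using lower_upper(1-3)[OF a] xy by auto
  define A where "A = {b \<in> V. vertical b \<and> snd (upper b) = y}"
  define L where "L = {b \<in> V. vertical b \<and> snd (upper b) = y \<and> fst (f b) < x}"
  define R where "R = {b \<in> V. vertical b \<and> snd (upper b) = y \<and> x < fst (f b)}"
  define U where "U = {b \<in> V. vertical b \<and> snd (upper b) = y + 1 \<and> fst (f b) < x}"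
  have fin: "finite L" "finite R" "finite U" by (simp_all add: L_def R_def U_def)
  have same: "b = a" if "b \<in> V" "vertical b" "snd (upper b) = y" "fst (f b) = x" for b
  proof (rule ccontr)
    assume "b \<noteq> a"
    moreover have "upper b = upper a"
      using lower_upper(3)[OF that(1,2)] that(3,4) xy by (simp add: prod_eq_iff)
    ultimately show False using upper_lower_distinct(1)[OF that(1) a(1)] by blast
  qed
  have "a \<in> A" using a xy by (simp add: A_def)
  moreover have "b \<in> insert a (L \<union> R)" if "b \<in> A" for b
    using that same[of b] linorder_less_linear[of "fst (f b)" x]
    unfolding A_def L_def R_def by blast
  moreover have "L \<union> R \<subseteq> A" unfolding A_def L_def R_def by blast
  ultimately have "A = insert a (L \<union> R)" by blast
  moreover have "a \<notin> L \<union> R" using x(1) by (simp add: L_def R_def)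
  moreover have "card (L \<union> R) = card L + card R"
    using fin by (intro card_Un_disjoint) (auto simp: L_def R_def)
  ultimately have A: "card A = Suc (card L + card R)" using fin by simp
  have "{b \<in> V. vertical b \<and> row_key (lower a) < row_key (lower b) \<and>
      row_key (lower b) < row_key (upper a) \<and> row_key (upper a) < row_key (upper b)} = R \<union> U"
    (is "?B = _")
  proof (rule Set.set_eqI)
    fix b
    show "b \<in> ?B \<longleftrightarrow> b \<in> R \<union> U"
    proof (cases "b \<in> V \<and> vertical b")
      case True
      then have b: "b \<in> V" "vertical b" by auto
      obtain y' where y': "snd (upper b) = y'" by blast
      note eqs = lower_upper(1-3)[OF b] y'
      show ?thesis
        unfolding mem_Collect_eq Un_iff R_def U_def row_key_less eqs x xy fst_conv snd_conv
        using b by auto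
    qed (auto simp: R_def U_def)
  qed
  moreover have "card (R \<union> U) = card R + card U"
    using fin by (intro card_Un_disjoint) (auto simp: R_def U_def)
  moreover have "even (card R + card U) \<longleftrightarrow> odd (card L + card U)"
    using even_verticals[of y] A by (auto simp: A_def)
  ultimately show ?thesis
    using even_left_of_vertical[OF a xy] by (simp only: x(1) xy snd_conv L_def U_def)
qed

text \<open>Only pairs of vertical dominoes contribute. Ordered by their lower cells, they are
  grouped by the earlier domino, which leaves the parity of its later crossings.\<close>

lemma prod_crossing_sign:
  "(\<Prod>(a, b)\<in>increasing_pairs (row_key \<circ> f) V. crossing_sign row_key (f a) (g a) (f b) (g b)) =
    (\<Prod>a\<in>V. if vertical a then
        if even (fst (f a) - row_start n (snd (upper a))) then - 1 else 1 else 1)"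
proof -
  define W where "W = {a \<in> V. vertical a}"
  have fin: "finite W" by (simp add: W_def)
  define h where "h a b = crossing_sign row_key (f a) (g a) (f b) (g b)" for a b
  define X where "X a = {b \<in> W. row_key (lower a) < row_key (lower b)}" for a
  define Y where "Y a = {b \<in> X a. row_key (lower b) < row_key (upper a) \<and> row_key (upper a) < row_key (upper b)}" for a
  have sym: "h a b = h b a" if "a \<in> V" "b \<in> V" for a b
  proof (cases "a = b")
    case False
    show ?thesis unfolding h_def
      using cells_distinct[OF that False] by (intro crossing_sign_swap) auto
  qed simp
  have inj: "inj_on (row_key \<circ> lower) W"
  proof (rule inj_onI)
    fix a b assume *: "a \<in> W" "b \<in> W" "(row_key \<circ> lower) a = (row_key \<circ> lower) b"
    then show "a = b"
      using upper_lower_distinct(3)[of a b] by (auto simp: W_def)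
  qed
  have inj_f: "inj_on (row_key \<circ> f) A" if "A \<subseteq> V" for A
    using that by (intro inj_onI) (metis comp_apply f_eq_iff row_key_eq subsetD)
  have "(\<Prod>(a, b)\<in>increasing_pairs (row_key \<circ> f) V. h a b) =
      (\<Prod>(a, b)\<in>increasing_pairs (row_key \<circ> f) W. h a b)"
  proof (rule prod.mono_neutral_right)
    show "increasing_pairs (row_key \<circ> f) W \<subseteq> increasing_pairs (row_key \<circ> f) V"
      by (auto simp: increasing_pairs_def W_def)
    show "\<forall>z\<in>increasing_pairs (row_key \<circ> f) V - increasing_pairs (row_key \<circ> f) W.
        (case z of (a, b) \<Rightarrow> h a b) = 1"
    proof
      fix z assume z: "z \<in> increasing_pairs (row_key \<circ> f) V - increasing_pairs (row_key \<circ> f) W"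
      obtain a b where ab: "z = (a, b)" by (cases z)
      have "a \<in> V" "b \<in> V" "a \<noteq> b" "\<not> (vertical a \<and> vertical b)"
        using z unfolding ab increasing_pairs_def W_def by auto
      then show "(case z of (a, b) \<Rightarrow> h a b) = 1"
        unfolding ab h_def by (simp add: crossing_sign_eq_1)
    qed
  qed simp
  also have "\<dots> = (\<Prod>(a, b)\<in>increasing_pairs (row_key \<circ> lower) W. h a b)"
    using sym prod_increasing_pairs_reindex[of "\<lambda>a. a" W W, OF _ inj_f inj, of h]
    by (auto simp: W_def bij_betw_def)
  also have "increasing_pairs (row_key \<circ> lower) W = Sigma W X"
    by (auto simp: increasing_pairs_def X_def)
  also have "(\<Prod>(a, b)\<in>Sigma W X. h a b) = (\<Prod>a\<in>W. \<Prod>b\<in>X a. h a b)"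
    using fin by (intro prod.Sigma[symmetric]) (auto simp: X_def)
  also have "\<dots> = (\<Prod>a\<in>W. if even (fst (f a) - row_start n (snd (upper a))) then - 1 else 1)"
  proof (rule prod.cong[OF refl])
    fix a assume a: "a \<in> W"
    have "(\<Prod>b\<in>X a. h a b) = (\<Prod>b\<in>X a. if b \<in> Y a then - 1 else 1)"
      using a unfolding h_def
      by (intro prod.cong refl) (simp add: crossing_sign_vertical X_def Y_def W_def del: row_key_less)
    also have "\<dots> = (\<Prod>b\<in>{b \<in> X a. b \<in> Y a}. - 1)"
      using fin by (intro prod.inter_filter[symmetric]) (simp add: X_def)
    also have "{b \<in> X a. b \<in> Y a} = Y a" unfolding Y_def by blast
    also have "(\<Prod>b\<in>Y a. - 1) = (- 1) ^ card (Y a)" by simp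
    also have "Y a = {b \<in> V. vertical b \<and> row_key (lower a) < row_key (lower b) \<and>
      row_key (lower b) < row_key (upper a) \<and> row_key (upper a) < row_key (upper b)}"
      by (auto simp: X_def Y_def W_def)
    finally show "(\<Prod>b\<in>X a. h a b) = (if even (fst (f a) - row_start n (snd (upper a))) then - 1 else 1)"
      using even_later_crossings[of a] a by (auto simp: W_def simp del: row_key_less)
  qed
  also have "\<dots> = (\<Prod>a\<in>V. if vertical a then
        if even (fst (f a) - row_start n (snd (upper a))) then - 1 else 1 else 1)"
    unfolding W_def by (subst prod.inter_filter[symmetric]) auto
  finally show ?thesis unfolding h_def .
qed

text \<open>Reference dominoes are disjoint and occupy adjacent cells of one row, so reading them by
  odd or by even cells gives the same order.\<close>

lemma row_key_odd_less_iff: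
  assumes "a \<in> V" "b \<in> V"
  shows "row_key (odd_cell n a) < row_key (odd_cell n b) \<longleftrightarrow>
    row_key (even_cell n a) < row_key (even_cell n b)"
  using assms by (cases a rule: vertex_cases; cases b rule: vertex_cases) auto

lemma prod_crossing_sign_reference:
  "(\<Prod>(a, b)\<in>increasing_pairs (row_key \<circ> f) V.
      crossing_sign row_key (f a) (even_cell n a) (f b) (even_cell n b)) = 1"
proof (rule prod.neutral, clarify)
  fix a b assume "(a, b) \<in> increasing_pairs (row_key \<circ> f) V"
  then have ab: "a \<in> V" "b \<in> V" "a \<noteq> b" by (auto simp: increasing_pairs_def)
  show "crossing_sign row_key (f a) (even_cell n a) (f b) (even_cell n b) = 1"
  proof (rule crossing_sign_horizontal)
    show "f b \<notin> {f a, even_cell n a}" "even_cell n b \<notin> {f a, even_cell n a}"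
      using ab odd_neq_even odd_neq_even[symmetric] inj_on_even_cell[of n]
      by (auto simp: f_eq_iff inj_on_def)
  qed (auto simp: odd_cell_def)
qed

text \<open>Once crossings are counted domino by domino, and as the reference tiling has none, the
  sign is a product of local signs to which the local Kasteleyn condition applies.\<close>

lemma sign_times_kasteleyn: "sign p * (\<Prod>a\<in>V. kasteleyn n a (p a)) = 1"
proof -
  have "sign p = (\<Prod>a\<in>V. if vertical a then
        if even (fst (f a) - row_start n (snd (upper a))) then - 1 else 1 else 1) *
      (\<Prod>a\<in>V. order_sign (row_key (f a)) (row_key (g a))) *
      (\<Prod>a\<in>V. order_sign (row_key (f a)) (row_key (even_cell n a)))"
    by (subst sign_eq_prod_crossing_sign[OF permutes, where f = f and g = "even_cell n" and \<kappa> = row_key])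
       (use inj_on_odd_cell[of n] inj_on_even_cell[of n] odd_neq_even row_key_odd_less_iff in
        \<open>auto simp: prod_crossing_sign prod_crossing_sign_reference inj_on_def simp del: row_key_less\<close>)
  also have "\<dots> = (\<Prod>a\<in>V. domino_sign n (f a) (g a) * order_sign (row_key (f a)) (row_key (even_cell n a)))"
    by (simp only: domino_sign_def prod.distrib mult_ac)
  finally have "sign p * (\<Prod>a\<in>V. kasteleyn n a (p a)) = (\<Prod>a\<in>V. row_sign a * row_sign (p a))"
    using domino_sign_kasteleyn[OF _ _ dominoes]
    by (simp flip: prod.distrib)
  \<comment> \<open>\<open>p\<close> permutes the vertices, so the gauge factors multiply to a
    square.\<close>
  also have "\<dots> = (\<Prod>a\<in>V. row_sign a) * (\<Prod>a\<in>V. row_sign a)"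
    using prod.permute[OF permutes, of row_sign] by (simp add: prod.distrib o_def)
  also have "\<dots> = 1" by (simp flip: prod.distrib)
  finally show ?thesis .
qed

end

theorem theorem5p7:
  fixes n :: nat
  assumes "n \<ge> 1"
  shows "int (card (domino_tilings (aztec_pillow n))) =
    det (four_block_mat
      (modified_schroeder_mat n) (1\<^sub>m n)
      (- 1\<^sub>m n) (exchange_mat n * modified_schroeder_mat n * exchange_mat n))"
proof -
  have "int (card (domino_tilings (aztec_pillow n))) = det_on (pillow_vertices n) (kasteleyn n)"
    by (rule card_tilings_eq_det) (rule pillow_matching.sign_times_kasteleyn, unfold_locales)
  then show ?thesis by (simp add: det_kasteleyn)
qed

end
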